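(* Let $A=(a_{ij})\in\mathbb{R}^{s\times s}$, $b=(b_j)\in\mathbb{R}^s$ be the coefficients of a Runge--Kutta method of order $p$, and let $\langle\cdot,\cdot\rangle$ be an inner product on $\mathbb{R}^m$ with norm $\|\cdot\|$. Consider the relaxation Runge--Kutta method with stages $$y_i = u^n+\Delta t\sum_{j=1}^s a_{ij} f_j,\qquad f_j=f(t_n+c_j\Delta t,y_j),\qquad i=1,\dots,s,$$ and update $$u^{n+1}_\gamma = u^n+\gamma_n\,\Delta t\sum_{j=1}^s b_j f_j,$$ where $$\gamma_n=\begin{cases}1 & \text{if } \bigl\|\sum_{j=1}^s b_jf_j\bigr\|^2=0,\\[1ex] \dfrac{2\sum_{i,j=1}^s b_ia_{ij}\langle f_i,f_j\rangle}{\sum_{i,j=1}^s b_ib_j\langle f_i,f_j\rangle} & \text{if } \bigl\|\sum_{j=1}^s b_jf_j\bigr\|^2\neq 0.\end{cases}$$ Then: 1. If $u^{n+1}_\gamma$ is interpreted as an approximation to $u(t_n+\Delta t)$, the method has order $p-1$. 2. If $u^{n+1}_\gamma$ is interpreted as an approximation to $u(t_n+\gamma_n\Delta t)$, the method has order $p$; i.e. the solution $u^1_\gamma$ after one step from $u^0=u(t_0)$ satisfies $$\|u^1_\gamma-u(t_0+\gamma_0\Delta t)\|=O(\Delta t^{p+1})\qquad(\Delta t\to 0).$$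
   Context: The initial value problem is $u'(t)=f(t,u(t))$, $u(t_0)=u_0$, with $u:\mathbb{R}\to\mathbb{R}^m$, $f:\mathbb{R}\times\mathbb{R}^m\to\mathbb{R}^m$ sufficiently smooth. $\Delta t>0$ is the step size, and $c_i=\sum_j a_{ij}$. For implicit methods and small $\Delta t$, $y_1,\dots,y_s$ is the solution of the stage equations near $u^n$. The unmodified Runge--Kutta method uses the same stages with update $u^{n+1}=u^n+\Delta t\sum_j b_jf_j$, and has order $p$ if for every problem with sufficiently smooth $f$ and exact starting data $u^n=u(t_n)$ one has $\|u^{n+1}-u(t_n+\Delta t)\|=O(\Delta t^{p+1})$ as $\Delta t\to0$. Likewise, a method whose output $u^{n+1}_\gamma$ is interpreted as an approximation to $u(\tau)$ (with $\tau=t_n+\Delta t$ or $\tau=t_n+\gamma_n\Delta t$) has order $q$ if, with $u^n=u(t_n)$, $\|u^{n+1}_\gamma-u(\tau)\|=O(\Delta t^{q+1})$. Here "order $q$" means at least $q$.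
   Formalization: Proved for p ≥ 1 and for starting data with f(t_0,u_0) ≠ 0 or f(t,u_0) = 0 for all t near t_0; otherwise false: f(t,u) = t, t_0 = u_0 = 0 with SSPRK3 (p = 3) gives γ = 2/3 and errors Δt²/6 and Δt²/9. *)

theory Defs
  imports "HOL-Analysis.Analysis" "HOL-Library.Landau_Symbols"
begin

text \<open>
  The order of a Runge--Kutta method quantifies over problems of every dimension, so the
  dimension has to be a number and not a type. Vectors of \<open>\<real>\<^sup>m\<close> are therefore the points of
  \<^const>\<open>Euclidean_space\<close>, i.e. functions \<open>nat \<Rightarrow> real\<close> vanishing at all indices \<open>\<ge> m\<close>.
  A method with \<open>s\<close> stages has coefficients \<open>A i j\<close>, \<open>b j\<close> with \<open>i, j < s\<close>.
\<close>

abbreviation Rn :: "nat \<Rightarrow> (nat \<Rightarrow> real) set" where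
  "Rn m \<equiv> topspace (Euclidean_space m)"

definition inner_product_on :: "nat \<Rightarrow> ((nat \<Rightarrow> real) \<Rightarrow> (nat \<Rightarrow> real) \<Rightarrow> real) \<Rightarrow> bool" where
  "inner_product_on m ip \<longleftrightarrow>
     (\<forall>x\<in>Rn m. \<forall>y\<in>Rn m. ip x y = ip y x) \<and>
     (\<forall>x\<in>Rn m. \<forall>y\<in>Rn m. \<forall>z\<in>Rn m. ip (\<lambda>k. x k + y k) z = ip x z + ip y z) \<and>
     (\<forall>c. \<forall>x\<in>Rn m. \<forall>y\<in>Rn m. ip (\<lambda>k. c * x k) y = c * ip x y) \<and>
     (\<forall>x\<in>Rn m. x \<noteq> (\<lambda>_. 0) \<longrightarrow> ip x x > 0)"

definition ip_norm :: "((nat \<Rightarrow> real) \<Rightarrow> (nat \<Rightarrow> real) \<Rightarrow> real) \<Rightarrow> (nat \<Rightarrow> real) \<Rightarrow> real" where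
  "ip_norm ip x = sqrt (ip x x)"

text \<open>
  \<open>C\<^sup>K\<close> functions \<open>\<real> \<times> \<real>\<^sup>m \<rightarrow> \<real>\<close>: all partial derivatives up to order \<open>K\<close>, in time and
  in the \<open>m\<close> space variables, exist and are jointly continuous.
\<close>

primrec C_diff :: "nat \<Rightarrow> nat \<Rightarrow> (real \<Rightarrow> (nat \<Rightarrow> real) \<Rightarrow> real) \<Rightarrow> bool" where
  "C_diff 0 m g \<longleftrightarrow>
     continuous_map (prod_topology euclideanreal (Euclidean_space m)) euclideanreal (\<lambda>(t, x). g t x)"
| "C_diff (Suc K) m g \<longleftrightarrow>
     continuous_map (prod_topology euclideanreal (Euclidean_space m)) euclideanreal (\<lambda>(t, x). g t x) \<and>
     (\<exists>g'. (\<forall>t. \<forall>x\<in>Rn m. ((\<lambda>\<tau>. g \<tau> x) has_real_derivative g' t x) (at t)) \<and> C_diff K m g') \<and>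
     (\<forall>i<m. \<exists>g'. (\<forall>t. \<forall>x\<in>Rn m. ((\<lambda>\<xi>. g t (x(i := \<xi>))) has_real_derivative g' t x) (at (x i))) \<and>
        C_diff K m g')"

definition smooth_rhs :: "nat \<Rightarrow> nat \<Rightarrow> (real \<Rightarrow> (nat \<Rightarrow> real) \<Rightarrow> (nat \<Rightarrow> real)) \<Rightarrow> bool" where
  "smooth_rhs K m f \<longleftrightarrow>
     (\<forall>t. \<forall>x\<in>Rn m. f t x \<in> Rn m) \<and> (\<forall>k<m. C_diff K m (\<lambda>t x. f t x k))"

text \<open>The exact solution is only required locally around \<open>t0\<close>, since it may blow up.\<close>

definition solves_ode :: "nat \<Rightarrow> (real \<Rightarrow> (nat \<Rightarrow> real) \<Rightarrow> (nat \<Rightarrow> real)) \<Rightarrow> real \<Rightarrow> (real \<Rightarrow> nat \<Rightarrow> real) \<Rightarrow> bool" where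
  "solves_ode m f t0 u \<longleftrightarrow>
     (\<forall>\<^sub>F t in nhds t0. u t \<in> Rn m \<and>
        (\<forall>k<m. ((\<lambda>\<tau>. u \<tau> k) has_real_derivative f t (u t) k) (at t)))"

definition rk_node :: "nat \<Rightarrow> (nat \<Rightarrow> nat \<Rightarrow> real) \<Rightarrow> nat \<Rightarrow> real" where
  "rk_node s A i = (\<Sum>j<s. A i j)"

definition rk_slope ::
  "nat \<Rightarrow> (nat \<Rightarrow> nat \<Rightarrow> real) \<Rightarrow> (real \<Rightarrow> (nat \<Rightarrow> real) \<Rightarrow> (nat \<Rightarrow> real)) \<Rightarrow> real \<Rightarrow>
   (real \<Rightarrow> nat \<Rightarrow> nat \<Rightarrow> real) \<Rightarrow> real \<Rightarrow> nat \<Rightarrow> (nat \<Rightarrow> real)" where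
  "rk_slope s A f t0 Y h j = f (t0 + rk_node s A j * h) (Y h j)"

text \<open>
  \<open>Y h i\<close> is the \<open>i\<close>-th stage for step size \<open>h\<close>. For implicit methods the stage equations may
  have several solutions; the limit condition selects the one near \<open>u0\<close>.
\<close>

definition rk_stages ::
  "nat \<Rightarrow> nat \<Rightarrow> (nat \<Rightarrow> nat \<Rightarrow> real) \<Rightarrow> (real \<Rightarrow> (nat \<Rightarrow> real) \<Rightarrow> (nat \<Rightarrow> real)) \<Rightarrow> real \<Rightarrow>
   (nat \<Rightarrow> real) \<Rightarrow> (real \<Rightarrow> nat \<Rightarrow> nat \<Rightarrow> real) \<Rightarrow> bool" where
  "rk_stages m s A f t0 u0 Y \<longleftrightarrow>
     (\<forall>\<^sub>F h in at_right 0. \<forall>i<s. Y h i \<in> Rn m \<and>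
        Y h i = (\<lambda>k. u0 k + h * (\<Sum>j<s. A i j * rk_slope s A f t0 Y h j k))) \<and>
     (\<forall>i<s. ((\<lambda>h. Y h i) \<longlongrightarrow> u0) (at_right 0))"

definition rk_increment :: "nat \<Rightarrow> (nat \<Rightarrow> real) \<Rightarrow> (nat \<Rightarrow> nat \<Rightarrow> real) \<Rightarrow> (nat \<Rightarrow> real)" where
  "rk_increment s b F = (\<lambda>k. \<Sum>j<s. b j * F j k)"

definition rk_update ::
  "nat \<Rightarrow> (nat \<Rightarrow> real) \<Rightarrow> (nat \<Rightarrow> real) \<Rightarrow> real \<Rightarrow> (nat \<Rightarrow> nat \<Rightarrow> real) \<Rightarrow> (nat \<Rightarrow> real)" where
  "rk_update s b u0 h F = (\<lambda>k. u0 k + h * rk_increment s b F k)"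

definition relaxation_gamma ::
  "nat \<Rightarrow> (nat \<Rightarrow> nat \<Rightarrow> real) \<Rightarrow> (nat \<Rightarrow> real) \<Rightarrow>
   ((nat \<Rightarrow> real) \<Rightarrow> (nat \<Rightarrow> real) \<Rightarrow> real) \<Rightarrow> (nat \<Rightarrow> nat \<Rightarrow> real) \<Rightarrow> real" where
  "relaxation_gamma s A b ip F =
     (if (ip_norm ip (rk_increment s b F))\<^sup>2 = 0 then 1
      else 2 * (\<Sum>i<s. \<Sum>j<s. b i * A i j * ip (F i) (F j))
             / (\<Sum>i<s. \<Sum>j<s. b i * b j * ip (F i) (F j)))"

definition relaxation_update ::
  "nat \<Rightarrow> (nat \<Rightarrow> nat \<Rightarrow> real) \<Rightarrow> (nat \<Rightarrow> real) \<Rightarrow>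
   ((nat \<Rightarrow> real) \<Rightarrow> (nat \<Rightarrow> real) \<Rightarrow> real) \<Rightarrow>
   (nat \<Rightarrow> real) \<Rightarrow> real \<Rightarrow> (nat \<Rightarrow> nat \<Rightarrow> real) \<Rightarrow> (nat \<Rightarrow> real)" where
  "relaxation_update s A b ip u0 h F =
     (\<lambda>k. u0 k + relaxation_gamma s A b ip F * h * rk_increment s b F k)"

text \<open>
  If \<open>f\<close> vanishes at the starting point but not at \<open>(t, u0)\<close> for nearby \<open>t\<close>, the increment may tend
  to zero and \<open>\<gamma>\<close> need not tend to \<open>1\<close>. Example: \<open>f t x = t\<close>, \<open>t0 = u0 = 0\<close> and the three-stage
  method of order 3 with rows \<open>(0)\<close>, \<open>(1)\<close>, \<open>(1/4, 1/4)\<close> and weights \<open>(1/6, 1/6, 2/3)\<close> give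
  \<open>\<gamma> = 2/3\<close> for every step size \<open>h\<close>, and the relaxed update is \<open>h\<^sup>2/3\<close> whereas the exact solution is
  \<open>t\<^sup>2/2\<close>. This is excluded here. Autonomous problems always satisfy the condition.
\<close>

definition nondegenerate_start :: "(real \<Rightarrow> (nat \<Rightarrow> real) \<Rightarrow> (nat \<Rightarrow> real)) \<Rightarrow> real \<Rightarrow> (nat \<Rightarrow> real) \<Rightarrow> bool" where
  "nondegenerate_start f t0 u0 \<longleftrightarrow>
     f t0 u0 \<noteq> (\<lambda>_. 0) \<or> (\<forall>\<^sub>F t in nhds t0. f t u0 = (\<lambda>_. 0))"

definition approx_of_order ::
  "((nat \<Rightarrow> real) \<Rightarrow> real) \<Rightarrow> nat \<Rightarrow> (real \<Rightarrow> nat \<Rightarrow> real) \<Rightarrow> (real \<Rightarrow> nat \<Rightarrow> real) \<Rightarrow> bool" where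
  "approx_of_order nrm q v w \<longleftrightarrow>
     (\<lambda>h. nrm (\<lambda>k. v h k - w h k)) \<in> O[at_right 0](\<lambda>h. h ^ (q + 1))"

text \<open>``Sufficiently smooth'' is rendered as: \<open>C\<^sup>K\<close> for some \<open>K\<close> depending only on the method.\<close>

definition rk_order :: "nat \<Rightarrow> (nat \<Rightarrow> nat \<Rightarrow> real) \<Rightarrow> (nat \<Rightarrow> real) \<Rightarrow> nat \<Rightarrow> bool" where
  "rk_order s A b p \<longleftrightarrow>
     (\<exists>K. \<forall>m f t0 u Y.
        smooth_rhs K m f \<longrightarrow> solves_ode m f t0 u \<longrightarrow> rk_stages m s A f t0 (u t0) Y \<longrightarrow>
        approx_of_order (\<lambda>x. L2_set x {..<m}) p
          (\<lambda>h. rk_update s b (u t0) h (rk_slope s A f t0 Y h)) (\<lambda>h. u (t0 + h)))"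

end

theory Submission
  imports Defs
begin

text \<open>
  The relaxed update differs from the ordinary one by \<open>(\<gamma> - 1) h X\<close>, where \<open>X = \<Sum>j b j f j\<close> is the
  increment, so everything rests on \<open>\<gamma> = 1 + O(h\<^sup>p\<^sup>-\<^sup>1)\<close>, which is lemma \<open>gamma_bigo\<close> below.

  To see this, write \<open>\<gamma> - 1 = - \<Delta> / \<parallel>X\<parallel>\<^sup>2\<close> with the defect
  \<open>\<Delta> = \<parallel>X\<parallel>\<^sup>2 - 2 \<Sum>i j b i a i j \<langle>f i, f j\<rangle>\<close>. Instead of expanding the defect in elementary
  differentials and matching order conditions, the order of the method is applied once more, to the
  system \<open>u' = f(t, u)\<close>, \<open>w' = 2 \<langle>f(t, u), u\<rangle>\<close> of dimension \<open>m + 1\<close>. Its exact solution started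
  on \<open>w = \<parallel>u\<parallel>\<^sup>2\<close> keeps this relation, whereas the method produces
  \<open>w1 = \<parallel>u0\<parallel>\<^sup>2 + 2 h \<Sum>j b j \<langle>f j, y j\<rangle>\<close> next to the ordinary update \<open>u1\<close> of \<open>u\<close>. Substituting the
  stage equations into \<open>w1\<close> gives the exact identity \<open>\<parallel>u1\<parallel>\<^sup>2 - w1 = h\<^sup>2 \<Delta>\<close> (\<open>energy_identity\<close>).
  Both \<open>\<parallel>u1\<parallel>\<^sup>2\<close> and \<open>w1\<close> approximate \<open>\<parallel>u(t0 + h)\<parallel>\<^sup>2\<close> up to \<open>O(h\<^sup>p\<^sup>+\<^sup>1)\<close>, whence
  \<open>\<Delta> = O(h\<^sup>p\<^sup>-\<^sup>1)\<close> (\<open>defect_bigo\<close>).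

  If \<open>f(t0, u0) \<noteq> 0\<close>, then \<open>X\<close> tends to \<open>f(t0, u0)\<close> and \<open>\<parallel>X\<parallel>\<^sup>2\<close> is bounded away from zero. In the
  other nondegenerate case \<open>f(t, u0) = 0\<close> for all \<open>t\<close> near \<open>t0\<close>; by a Lipschitz estimate the stages
  near \<open>u0\<close> then equal \<open>u0\<close> for small \<open>h\<close>, the increment vanishes, and \<open>\<gamma> = 1\<close>.

  The first claim is now immediate. For the second,
  \<open>u(t0 + \<gamma> h) - u(t0 + h) = (\<gamma> - 1) h (f(t0, u0) + O(h))\<close> by the mean value theorem, and also
  \<open>X = f(t0, u0) + O(h)\<close>. So shifting the time at which the solution is evaluated cancels the
  perturbation \<open>(\<gamma> - 1) h X\<close> of the update up to \<open>O(h\<^sup>p\<^sup>-\<^sup>1 h h) = O(h\<^sup>p\<^sup>+\<^sup>1)\<close>.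

  One derivative more than the order condition asks for is required of \<open>f\<close>, so that \<open>f\<close> is
  locally Lipschitz even if the order condition only asks for continuity.
\<close>

section \<open>Continuously differentiable right-hand sides\<close>

lemma Rn_iff: "x \<in> Rn m \<longleftrightarrow> (\<forall>i\<ge>m. x i = 0)"
  by (simp add: topspace_Euclidean_space)

lemma tendsto_fun_iff:
  fixes g :: "'a \<Rightarrow> 'b \<Rightarrow> 'c::topological_space"
  shows "(g \<longlongrightarrow> l) F \<longleftrightarrow> (\<forall>k. ((\<lambda>x. g x k) \<longlongrightarrow> l k) F)"
  using limitin_componentwise[of "\<lambda>_. euclidean" UNIV g l F]
  by (simp add: euclidean_product_topology)

lemma C_diff_0_iff:
  "C_diff 0 m g \<longleftrightarrow> continuous_on (UNIV \<times> Rn m) (\<lambda>(t, x). g t x)"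
proof -
  have "Euclidean_space m = top_of_set (Rn m)"
    by (simp add: Euclidean_space_def euclidean_product_topology)
  then have "prod_topology euclideanreal (Euclidean_space m) = top_of_set (UNIV \<times> Rn m)"
    by (metis prod_topology_subtopology_eu subtopology_UNIV)
  then show ?thesis
    by simp
qed

lemma C_diff_continuous:
  assumes "C_diff K m g"
  shows "continuous_on (UNIV \<times> Rn m) (\<lambda>(t, x). g t x)"
proof -
  have "C_diff 0 m g"
    using assms by (cases K) auto
  then show ?thesis
    by (simp only: C_diff_0_iff)
qed

text \<open>
  The same as the recursion equation, but with the continuity clause again expressed through
  \<^const>\<open>C_diff\<close>, so that unfolding it leaves nothing topological behind.
\<close>

lemma C_diff_Suc_iff:
  "C_diff (Suc K) m g \<longleftrightarrow> C_diff 0 m g \<and>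
     (\<exists>g'. (\<forall>t. \<forall>x\<in>Rn m. ((\<lambda>\<tau>. g \<tau> x) has_real_derivative g' t x) (at t)) \<and> C_diff K m g') \<and>
     (\<forall>i<m. \<exists>g'. (\<forall>t. \<forall>x\<in>Rn m. ((\<lambda>\<xi>. g t (x(i := \<xi>))) has_real_derivative g' t x) (at (x i))) \<and>
        C_diff K m g')"
  by simp

lemma C_diff_Suc_timeE:
  assumes "C_diff (Suc K) m g"
  obtains g' where
    "\<And>t x. x \<in> Rn m \<Longrightarrow> ((\<lambda>\<tau>. g \<tau> x) has_real_derivative g' t x) (at t)" "C_diff K m g'"
  using assms unfolding C_diff_Suc_iff by blast

lemma C_diff_Suc_spaceE:
  assumes "C_diff (Suc K) m g" "i < m"
  obtains g' where
    "\<And>t x. x \<in> Rn m \<Longrightarrow> ((\<lambda>\<xi>. g t (x(i := \<xi>))) has_real_derivative g' t x) (at (x i))"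
    "C_diff K m g'"
  using assms unfolding C_diff_Suc_iff by blast

lemma C_diff_Suc_D: "C_diff (Suc K) m g \<Longrightarrow> C_diff K m g"
proof (induction K arbitrary: g)
  case (Suc K)
  then show ?case
    unfolding C_diff_Suc_iff[of "Suc K"] C_diff_Suc_iff[of K] by blast
qed simp

lemma C_diff_const: "C_diff K m (\<lambda>t x. c)"
proof (induction K arbitrary: c)
  case 0
  show ?case
    by (simp add: C_diff_0_iff del: C_diff.simps)
next
  case (Suc K)
  have "C_diff 0 m (\<lambda>t x. c)"
    by (simp add: C_diff_0_iff del: C_diff.simps)
  with Suc show ?case
    unfolding C_diff_Suc_iff by (auto intro!: exI[of _ "\<lambda>t x. 0"] simp del: C_diff.simps)
qed

lemma C_diff_coord: "i < m \<Longrightarrow> C_diff K m (\<lambda>t x. x i)"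
proof (cases K)
  have *: "C_diff 0 m (\<lambda>t x. x i)"
    unfolding C_diff_0_iff case_prod_unfold
    by (rule continuous_on_product_then_coordinatewise) (intro continuous_on_snd continuous_on_id)
  {
    case 0
    with * show ?thesis by simp
  next
    case (Suc L)
    have "((\<lambda>\<xi>. (x(j := \<xi>)) i) has_real_derivative (if i = j then 1 else 0)) (at (x j))"
      for j and x :: "nat \<Rightarrow> real"
      by auto
    then have "\<exists>g'. (\<forall>t. \<forall>x\<in>Rn m. ((\<lambda>\<xi>. (x(j := \<xi>)) i) has_real_derivative g' t x) (at (x j)))
        \<and> C_diff L m g'" for j
      by (intro exI[of _ "\<lambda>t x. if i = j then 1 else 0"] conjI allI ballI C_diff_const) blast
    moreover have "\<exists>g'. (\<forall>t. \<forall>x\<in>Rn m. ((\<lambda>\<tau>. x i) has_real_derivative g' t x) (at t)) \<and> C_diff L m g'"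
      by (intro exI[of _ "\<lambda>t x. 0"] conjI allI ballI C_diff_const) auto
    ultimately show ?thesis
      using * unfolding Suc C_diff_Suc_iff by blast
  }
qed

lemma C_diff_add:
  "C_diff K m g \<Longrightarrow> C_diff K m h \<Longrightarrow> C_diff K m (\<lambda>t x. g t x + h t x)"
proof (induction K arbitrary: g h)
  case 0
  then show ?case
    unfolding C_diff_0_iff case_prod_unfold by (intro continuous_intros)
next
  case (Suc K)
  have 0: "C_diff 0 m (\<lambda>t x. g t x + h t x)"
    using Suc.prems[THEN C_diff_continuous] unfolding C_diff_0_iff case_prod_unfold
    by (intro continuous_intros)
  obtain gt ht where
    "\<And>t x. x \<in> Rn m \<Longrightarrow> ((\<lambda>\<tau>. g \<tau> x) has_real_derivative gt t x) (at t)" "C_diff K m gt"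
    "\<And>t x. x \<in> Rn m \<Longrightarrow> ((\<lambda>\<tau>. h \<tau> x) has_real_derivative ht t x) (at t)" "C_diff K m ht"
    using Suc.prems unfolding C_diff_Suc_iff by metis
  then have t: "\<exists>d. (\<forall>t. \<forall>x\<in>Rn m. ((\<lambda>\<tau>. g \<tau> x + h \<tau> x) has_real_derivative d t x) (at t)) \<and> C_diff K m d"
    by (intro exI[of _ "\<lambda>t x. gt t x + ht t x"] conjI allI ballI DERIV_add Suc.IH) blast+
  have "\<exists>d. (\<forall>t. \<forall>x\<in>Rn m. ((\<lambda>\<xi>. g t (x(i := \<xi>)) + h t (x(i := \<xi>))) has_real_derivative d t x) (at (x i)))
      \<and> C_diff K m d" if "i < m" for i
  proof -
    obtain gi where gi:
      "\<And>t x. x \<in> Rn m \<Longrightarrow> ((\<lambda>\<xi>. g t (x(i := \<xi>))) has_real_derivative gi t x) (at (x i))" "C_diff K m gi"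
      using C_diff_Suc_spaceE[OF Suc.prems(1) \<open>i < m\<close>] by blast
    obtain hi where hi:
      "\<And>t x. x \<in> Rn m \<Longrightarrow> ((\<lambda>\<xi>. h t (x(i := \<xi>))) has_real_derivative hi t x) (at (x i))" "C_diff K m hi"
      using C_diff_Suc_spaceE[OF Suc.prems(2) \<open>i < m\<close>] by blast
    have "((\<lambda>\<xi>. g t (x(i := \<xi>)) + h t (x(i := \<xi>))) has_real_derivative gi t x + hi t x) (at (x i))"
      if "x \<in> Rn m" for t x
      by (intro DERIV_add gi(1) hi(1) that)
    then show ?thesis
      by (intro exI[of _ "\<lambda>t x. gi t x + hi t x"] conjI allI ballI Suc.IH gi(2) hi(2))
  qed
  with 0 t show ?case
    unfolding C_diff_Suc_iff by blast
qed

lemma C_diff_mult: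
  "C_diff K m g \<Longrightarrow> C_diff K m h \<Longrightarrow> C_diff K m (\<lambda>t x. g t x * h t x)"
proof (induction K arbitrary: g h)
  case 0
  then show ?case
    unfolding C_diff_0_iff case_prod_unfold by (intro continuous_intros)
next
  case (Suc K)
  have 0: "C_diff 0 m (\<lambda>t x. g t x * h t x)"
    using Suc.prems[THEN C_diff_continuous] unfolding C_diff_0_iff case_prod_unfold
    by (intro continuous_intros)
  note low = Suc.prems[THEN C_diff_Suc_D]
  obtain gt ht where
    "\<And>t x. x \<in> Rn m \<Longrightarrow> ((\<lambda>\<tau>. g \<tau> x) has_real_derivative gt t x) (at t)" "C_diff K m gt"
    "\<And>t x. x \<in> Rn m \<Longrightarrow> ((\<lambda>\<tau>. h \<tau> x) has_real_derivative ht t x) (at t)" "C_diff K m ht"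
    using Suc.prems unfolding C_diff_Suc_iff by metis
  then have t: "\<exists>d. (\<forall>t. \<forall>x\<in>Rn m. ((\<lambda>\<tau>. g \<tau> x * h \<tau> x) has_real_derivative d t x) (at t)) \<and> C_diff K m d"
    using low
    by (intro exI[of _ "\<lambda>t x. gt t x * h t x + ht t x * g t x"] conjI allI ballI DERIV_mult C_diff_add Suc.IH) blast+
  have "\<exists>d. (\<forall>t. \<forall>x\<in>Rn m. ((\<lambda>\<xi>. g t (x(i := \<xi>)) * h t (x(i := \<xi>))) has_real_derivative d t x) (at (x i)))
      \<and> C_diff K m d" if "i < m" for i
  proof -
    obtain gi where gi:
      "\<And>t x. x \<in> Rn m \<Longrightarrow> ((\<lambda>\<xi>. g t (x(i := \<xi>))) has_real_derivative gi t x) (at (x i))" "C_diff K m gi"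
      using C_diff_Suc_spaceE[OF Suc.prems(1) \<open>i < m\<close>] by blast
    obtain hi where hi:
      "\<And>t x. x \<in> Rn m \<Longrightarrow> ((\<lambda>\<xi>. h t (x(i := \<xi>))) has_real_derivative hi t x) (at (x i))" "C_diff K m hi"
      using C_diff_Suc_spaceE[OF Suc.prems(2) \<open>i < m\<close>] by blast
    have "((\<lambda>\<xi>. g t (x(i := \<xi>)) * h t (x(i := \<xi>))) has_real_derivative gi t x * h t x + hi t x * g t x) (at (x i))"
      if "x \<in> Rn m" for t x
      using DERIV_mult[OF gi(1)[OF that] hi(1)[OF that]] by simp
    then show ?thesis
      using low gi(2) hi(2)
      by (intro exI[of _ "\<lambda>t x. gi t x * h t x + hi t x * g t x"] conjI allI ballI C_diff_add Suc.IH)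
  qed
  with 0 t show ?case
    unfolding C_diff_Suc_iff by blast
qed

lemma C_diff_sum:
  assumes "\<And>i. i \<in> I \<Longrightarrow> C_diff K m (g i)"
  shows "C_diff K m (\<lambda>t x. \<Sum>i\<in>I. g i t x)"
  using assms
proof (induction I rule: infinite_finite_induct)
  case (insert i I)
  then have "C_diff K m (\<lambda>t x. g i t x + (\<Sum>i\<in>I. g i t x))"
    by (intro C_diff_add) blast+
  with insert show ?case
    by simp
qed (simp_all add: C_diff_const)

text \<open>
  A component of the given system, read as a component of the system with one more unknown. The new
  coordinate is reset to zero because \<open>g\<close> is only controlled on points of dimension \<open>m\<close>.
\<close>

lemma C_diff_lift:
  "C_diff K m g \<Longrightarrow> C_diff K (Suc m) (\<lambda>t x. g t (x(m := 0)))"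
proof (induction K arbitrary: g)
  have cont: "C_diff 0 (Suc m) (\<lambda>t x. g t (x(m := 0)))" if "C_diff L m g" for L g
  proof -
    have sub: "(\<lambda>y. (fst y, (snd y)(m := 0))) ` (UNIV \<times> Rn (Suc m)) \<subseteq> UNIV \<times> Rn m"
      by (auto simp: Rn_iff)
    have "continuous_on A (\<lambda>x. (snd x) i)"
      for A :: "(real \<times> (nat \<Rightarrow> real)) set" and i
      by (rule continuous_on_product_then_coordinatewise) (intro continuous_on_snd continuous_on_id)
    then have "continuous_on A (\<lambda>x. ((snd x)(m := 0)) i)"
      for A :: "(real \<times> (nat \<Rightarrow> real)) set" and i
      by (cases "i = m") simp_all
    then have "continuous_on (UNIV \<times> Rn (Suc m)) (\<lambda>y. (fst y :: real, (snd y)(m := 0)))"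
      by (intro continuous_on_Pair continuous_on_coordinatewise_then_product continuous_on_fst continuous_on_id)
    from continuous_on_compose2[OF C_diff_continuous[OF that] this sub]
    show ?thesis
      unfolding C_diff_0_iff case_prod_unfold by simp
  qed
  {
    case 0
    then show ?case by (rule cont)
  next
    case (Suc K)
    have low: "x(m := 0) \<in> Rn m" if "x \<in> Rn (Suc m)" for x :: "nat \<Rightarrow> real"
      using that by (auto simp: Rn_iff)
    obtain gt where
      "\<And>t x. x \<in> Rn m \<Longrightarrow> ((\<lambda>\<tau>. g \<tau> x) has_real_derivative gt t x) (at t)" "C_diff K m gt"
      using Suc.prems unfolding C_diff_Suc_iff by metis
    with low have t: "\<exists>d. (\<forall>t. \<forall>x\<in>Rn (Suc m). ((\<lambda>\<tau>. g \<tau> (x(m := 0))) has_real_derivative d t x) (at t))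
        \<and> C_diff K (Suc m) d"
      by (intro exI[of _ "\<lambda>t x. gt t (x(m := 0))"] conjI allI ballI Suc.IH) blast+
    have "\<exists>d. (\<forall>t. \<forall>x\<in>Rn (Suc m). ((\<lambda>\<xi>. g t (x(i := \<xi>, m := 0))) has_real_derivative d t x) (at (x i)))
        \<and> C_diff K (Suc m) d" if "i < Suc m" for i
    proof (cases "i = m")
      case True
      then show ?thesis
        by (intro exI[of _ "\<lambda>t x. 0"] conjI allI ballI C_diff_const) simp
    next
      case False
      with that have "i < m" by simp
      then obtain gi where d:
        "\<And>t x. x \<in> Rn m \<Longrightarrow> ((\<lambda>\<xi>. g t (x(i := \<xi>))) has_real_derivative gi t x) (at (x i))" "C_diff K m gi"
        using Suc.prems unfolding C_diff_Suc_iff by metis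
      have "((\<lambda>\<xi>. g t (x(i := \<xi>, m := 0))) has_real_derivative gi t (x(m := 0))) (at (x i))"
        if "x \<in> Rn (Suc m)" for t x
        using d(1)[OF low[OF that], of t] False by (simp add: fun_upd_twist)
      with d(2) show ?thesis
        by (intro exI[of _ "\<lambda>t x. gi t (x(m := 0))"] conjI allI ballI Suc.IH) blast+
    qed
    with t cont[OF Suc.prems] show ?case
      unfolding C_diff_Suc_iff by blast
  }
qed

lemma smooth_rhs_mono: "smooth_rhs (Suc K) m f \<Longrightarrow> smooth_rhs K m f"
  unfolding smooth_rhs_def using C_diff_Suc_D by blast

section \<open>Local Lipschitz estimates\<close>

text \<open>
  Boxes rather than balls of a metric: they shrink to the point in the product topology, and they
  contain, with two points, each point obtained by mixing their coordinates. The estimate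
  along coordinate directions below moves through such points.
\<close>

definition in_box :: "nat \<Rightarrow> real \<Rightarrow> real \<Rightarrow> (nat \<Rightarrow> real) \<Rightarrow> real \<Rightarrow> (nat \<Rightarrow> real) \<Rightarrow> bool" where
  "in_box m \<delta> t0 u0 t x \<longleftrightarrow> \<bar>t - t0\<bar> < \<delta> \<and> x \<in> Rn m \<and> (\<forall>k<m. \<bar>x k - u0 k\<bar> < \<delta>)"

text \<open>
  Asking for this eventually as \<open>\<delta>\<close> decreases to zero allows several such statements to be met by one box.
  In the finite-dimensional \<^term>\<open>Rn m\<close> only the first \<open>m\<close> coordinates restrict membership in a
  basic open set of the product topology, all the others being zero.
\<close>

lemma eventually_box_subset:
  assumes "open U" "(t0, u0) \<in> U" "u0 \<in> Rn m"
  shows "\<forall>\<^sub>F \<delta> in at_right 0. \<forall>t x. in_box m \<delta> t0 u0 t x \<longrightarrow> (t, x) \<in> U"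
proof -
  obtain S V where SV: "open S" "open V" "t0 \<in> S" "u0 \<in> V" "S \<times> V \<subseteq> U"
    using assms(1,2) by (metis mem_Sigma_iff open_prod_elim)
  have "openin (product_topology (\<lambda>_. euclideanreal) UNIV) V"
    using SV(2) by (simp add: open_fun_def)
  from product_topology_open_contains_basis[OF this SV(4)] obtain X where
    X: "u0 \<in> (\<Pi>\<^sub>E i\<in>UNIV. X i)" "\<And>i. open (X i)" "(\<Pi>\<^sub>E i\<in>UNIV. X i) \<subseteq> V"
    by auto
  have nbhd: "\<forall>\<^sub>F \<delta> in at_right 0. \<forall>y. \<bar>y - a\<bar> < \<delta> \<longrightarrow> y \<in> W" if "open W" "a \<in> W" for W and a :: real
  proof -
    obtain e where "e > 0" "ball a e \<subseteq> W"
      using openE[OF \<open>open W\<close> \<open>a \<in> W\<close>] .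
    then show ?thesis
      unfolding eventually_at_right_field
      by (intro exI[of _ e]) (auto simp: subset_iff dist_real_def abs_minus_commute)
  qed
  have "\<forall>\<^sub>F \<delta> in at_right 0. \<forall>y. \<bar>y - t0\<bar> < \<delta> \<longrightarrow> y \<in> S"
    using SV by (intro nbhd)
  moreover have "\<forall>\<^sub>F \<delta> in at_right 0. \<forall>k\<in>{..<m}. \<forall>y. \<bar>y - u0 k\<bar> < \<delta> \<longrightarrow> y \<in> X k"
    using X by (intro eventually_ball_finite ballI nbhd) auto
  ultimately show ?thesis
  proof eventually_elim
    case (elim \<delta>)
    show ?case
    proof (intro allI impI)
      fix t x assume box: "in_box m \<delta> t0 u0 t x"
      have "x k \<in> X k" for k
      proof (cases "k < m")
        case False
        then have "x k = u0 k"
          using box assms(3) by (simp add: in_box_def Rn_iff)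
        with X(1) show ?thesis by auto
      qed (use box elim in \<open>auto simp: in_box_def\<close>)
      then have "x \<in> V"
        using X(3) by (auto simp: PiE_def)
      moreover have "t \<in> S"
        using box elim by (auto simp: in_box_def)
      ultimately show "(t, x) \<in> U"
        using SV by auto
    qed
  qed
qed

lemma C_diff_locally_bounded:
  assumes "C_diff K m g" "u0 \<in> Rn m"
  shows "\<exists>M\<ge>0. \<forall>\<^sub>F \<delta> in at_right 0. \<forall>t x. in_box m \<delta> t0 u0 t x \<longrightarrow> \<bar>g t x\<bar> \<le> M"
proof -
  have "((\<lambda>(t, x). g t x) \<longlongrightarrow> g t0 u0) (at (t0, u0) within UNIV \<times> Rn m)"
    using C_diff_continuous[OF assms(1)] assms(2) by (auto simp: continuous_on_def)
  then have "\<forall>\<^sub>F y in at (t0, u0) within UNIV \<times> Rn m. dist (case y of (t, x) \<Rightarrow> g t x) (g t0 u0) < 1"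
    by (rule tendstoD) simp
  then obtain U where U: "open U" "(t0, u0) \<in> U"
    "\<And>y. y \<in> U \<Longrightarrow> y \<noteq> (t0, u0) \<Longrightarrow> y \<in> UNIV \<times> Rn m \<Longrightarrow> dist (case y of (t, x) \<Rightarrow> g t x) (g t0 u0) < 1"
    unfolding eventually_at_topological by blast
  have M: "\<bar>g t x\<bar> \<le> \<bar>g t0 u0\<bar> + 1" if "(t, x) \<in> U" "x \<in> Rn m" for t x
    using U(3)[of "(t, x)"] that by (cases "(t, x) = (t0, u0)") (auto simp: dist_real_def)
  have "\<forall>\<^sub>F \<delta> in at_right 0. \<forall>t x. in_box m \<delta> t0 u0 t x \<longrightarrow> \<bar>g t x\<bar> \<le> \<bar>g t0 u0\<bar> + 1"
    using eventually_box_subset[OF U(1,2) assms(2)]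
  proof eventually_elim
    case (elim \<delta>)
    then show ?case
      using M by (auto simp: in_box_def)
  qed
  then show ?thesis
    by (intro exI[of _ "\<bar>g t0 u0\<bar> + 1"]) auto
qed

text \<open>
  Time is changed in one step and space one coordinate at a time; each step is an application of
  the mean value theorem to a partial derivative that is bounded on a small box.
\<close>

lemma C_diff_locally_Lipschitz:
  assumes "C_diff (Suc K) m g" "u0 \<in> Rn m"
  shows "\<exists>L\<ge>0. \<forall>\<^sub>F \<delta> in at_right 0. \<forall>t x. in_box m \<delta> t0 u0 t x \<longrightarrow>
    \<bar>g t x - g t u0\<bar> \<le> L * (\<Sum>i<m. \<bar>x i - u0 i\<bar>) \<and> \<bar>g t x - g t0 x\<bar> \<le> L * \<bar>t - t0\<bar>"
proof -
  obtain gt where gt: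
    "\<And>t x. x \<in> Rn m \<Longrightarrow> ((\<lambda>\<tau>. g \<tau> x) has_real_derivative gt t x) (at t)" "C_diff K m gt"
    using C_diff_Suc_timeE[OF assms(1)] by blast
  have "\<forall>i<m. \<exists>d. (\<forall>t. \<forall>x\<in>Rn m. ((\<lambda>\<xi>. g t (x(i := \<xi>))) has_real_derivative d t x) (at (x i)))
     \<and> C_diff K m d"
    using assms(1) unfolding C_diff_Suc_iff by blast
  then obtain d where d: "\<And>i t x. i < m \<Longrightarrow> x \<in> Rn m \<Longrightarrow>
      ((\<lambda>\<xi>. g t (x(i := \<xi>))) has_real_derivative d i t x) (at (x i))" "\<And>i. i < m \<Longrightarrow> C_diff K m (d i)"
    by metis
  obtain M where M: "M \<ge> 0" "\<forall>\<^sub>F \<delta> in at_right 0. \<forall>t x. in_box m \<delta> t0 u0 t x \<longrightarrow> \<bar>gt t x\<bar> \<le> M"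
    using C_diff_locally_bounded[OF gt(2) assms(2)] by blast
  have "\<forall>i\<in>{..<m}. \<exists>N\<ge>0. \<forall>\<^sub>F \<delta> in at_right 0. \<forall>t x. in_box m \<delta> t0 u0 t x \<longrightarrow> \<bar>d i t x\<bar> \<le> N"
    using C_diff_locally_bounded[OF d(2) assms(2)] by simp
  from bchoice[OF this] obtain N where "\<forall>i\<in>{..<m}. N i \<ge> 0 \<and>
      (\<forall>\<^sub>F \<delta> in at_right 0. \<forall>t x. in_box m \<delta> t0 u0 t x \<longrightarrow> \<bar>d i t x\<bar> \<le> N i)" ..
  then have N: "\<And>i. i < m \<Longrightarrow> N i \<ge> 0"
    "\<And>i. i \<in> {..<m} \<Longrightarrow> \<forall>\<^sub>F \<delta> in at_right 0. \<forall>t x. in_box m \<delta> t0 u0 t x \<longrightarrow> \<bar>d i t x\<bar> \<le> N i"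
    by simp_all
  define L where "L = M + (\<Sum>i<m. N i)"
  have NL: "N i \<le> L" if "i < m" for i
    using that N(1) M(1) member_le_sum[of i "{..<m}" N] by (simp add: L_def)
  have "L \<ge> M" "L \<ge> 0"
    using M(1) N(1) by (auto simp: L_def intro!: sum_nonneg add_nonneg_nonneg)
  have "\<forall>\<^sub>F \<delta> in at_right 0. \<forall>i\<in>{..<m}. \<forall>t x. in_box m \<delta> t0 u0 t x \<longrightarrow> \<bar>d i t x\<bar> \<le> N i"
    using N(2) by (intro eventually_ball_finite ballI) auto
  with M(2) have "\<forall>\<^sub>F \<delta> in at_right 0. \<forall>t x. in_box m \<delta> t0 u0 t x \<longrightarrow>
    \<bar>g t x - g t u0\<bar> \<le> L * (\<Sum>i<m. \<bar>x i - u0 i\<bar>) \<and> \<bar>g t x - g t0 x\<bar> \<le> L * \<bar>t - t0\<bar>"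
  proof eventually_elim
    case (elim \<delta>)
    show ?case
    proof (intro allI impI)
      fix t x assume box: "in_box m \<delta> t0 u0 t x"
      \<comment> \<open>the first \<open>n\<close> coordinates have been moved from \<open>u0\<close> to \<open>x\<close>\<close>
      define z where "z n = (\<lambda>k. if k < n then x k else u0 k)" for n
      have step: "\<bar>g t (z (Suc n)) - g t (z n)\<bar> \<le> L * \<bar>x n - u0 n\<bar>" if "n < m" for n
      proof -
        have "norm (g t ((z n)(n := x n)) - g t ((z n)(n := u0 n))) \<le> L * norm (x n - u0 n)"
        proof (rule field_differentiable_bound[where S = "closed_segment (u0 n) (x n)"])
          fix \<xi> assume \<xi>: "\<xi> \<in> closed_segment (u0 n) (x n)"
          let ?y = "(z n)(n := \<xi>)"
          have "\<bar>\<xi> - u0 n\<bar> \<le> \<bar>x n - u0 n\<bar>"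
            using \<xi> by (auto simp: closed_segment_eq_real_ivl split: if_splits)
          also have "\<dots> < \<delta>"
            using box that by (simp add: in_box_def)
          finally have "in_box m \<delta> t0 u0 t ?y"
            using box assms(2) that by (auto simp: in_box_def Rn_iff z_def)
          then have "\<bar>d n t ?y\<bar> \<le> N n"
            using elim(2) that by blast
          with NL[OF that] show "norm (d n t ?y) \<le> L"
            by simp
          have "?y \<in> Rn m"
            using assms(2) box that by (auto simp: in_box_def Rn_iff z_def)
          from d(1)[OF that this, of t]
          show "((\<lambda>\<xi>. g t ((z n)(n := \<xi>))) has_real_derivative d n t ?y) (at \<xi> within closed_segment (u0 n) (x n))"
            by (auto intro: has_field_derivative_at_within)
        qed auto
        moreover have "(z n)(n := x n) = z (Suc n)" "(z n)(n := u0 n) = z n"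
          by (auto simp: z_def fun_eq_iff)
        ultimately show ?thesis
          by simp
      qed
      have "\<bar>g t (z n) - g t u0\<bar> \<le> L * (\<Sum>i<n. \<bar>x i - u0 i\<bar>)" if "n \<le> m" for n
        using that
      proof (induction n)
        case 0
        then show ?case by (simp add: z_def)
      next
        case (Suc n)
        then show ?case
          using step[of n] by (simp add: distrib_left)
      qed
      moreover have "z m = x"
        using box assms(2) by (auto simp: z_def in_box_def Rn_iff fun_eq_iff)
      ultimately have "\<bar>g t x - g t u0\<bar> \<le> L * (\<Sum>i<m. \<bar>x i - u0 i\<bar>)"
        by (metis order_refl)
      moreover have "norm (g t x - g t0 x) \<le> L * norm (t - t0)"
      proof (rule field_differentiable_bound[where S = "closed_segment t0 t"])
        fix \<tau> assume \<tau>: "\<tau> \<in> closed_segment t0 t"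
        have "\<bar>\<tau> - t0\<bar> \<le> \<bar>t - t0\<bar>"
          using \<tau> by (auto simp: closed_segment_eq_real_ivl split: if_splits)
        then have "in_box m \<delta> t0 u0 \<tau> x"
          using box by (simp add: in_box_def)
        then have "\<bar>gt \<tau> x\<bar> \<le> M"
          using elim(1) by blast
        with \<open>L \<ge> M\<close> show "norm (gt \<tau> x) \<le> L"
          by simp
        show "((\<lambda>\<tau>. g \<tau> x) has_real_derivative gt \<tau> x) (at \<tau> within closed_segment t0 t)"
          using box unfolding in_box_def by (intro has_field_derivative_at_within[OF gt(1)]) blast
      qed auto
      ultimately show "\<bar>g t x - g t u0\<bar> \<le> L * (\<Sum>i<m. \<bar>x i - u0 i\<bar>) \<and> \<bar>g t x - g t0 x\<bar> \<le> L * \<bar>t - t0\<bar>"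
        by simp
    qed
  qed
  with \<open>L \<ge> 0\<close> show ?thesis by blast
qed

lemma smooth_rhs_locally_Lipschitz:
  assumes "smooth_rhs (Suc K) m f" "u0 \<in> Rn m"
  obtains L \<delta> where "L \<ge> 0" "\<delta> > 0"
    "\<And>t x k. in_box m \<delta> t0 u0 t x \<Longrightarrow> k < m \<Longrightarrow> \<bar>f t x k - f t u0 k\<bar> \<le> L * (\<Sum>i<m. \<bar>x i - u0 i\<bar>)"
    "\<And>t x k. in_box m \<delta> t0 u0 t x \<Longrightarrow> k < m \<Longrightarrow> \<bar>f t x k - f t0 x k\<bar> \<le> L * \<bar>t - t0\<bar>"
proof -
  let ?P = "\<lambda>k L \<delta>. \<forall>t x. in_box m \<delta> t0 u0 t x \<longrightarrow>
    \<bar>f t x k - f t u0 k\<bar> \<le> L * (\<Sum>i<m. \<bar>x i - u0 i\<bar>) \<and> \<bar>f t x k - f t0 x k\<bar> \<le> L * \<bar>t - t0\<bar>"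
  have "\<forall>k\<in>{..<m}. \<exists>L\<ge>0. \<forall>\<^sub>F \<delta> in at_right 0. ?P k L \<delta>"
    using assms(1) unfolding smooth_rhs_def
    by (intro ballI C_diff_locally_Lipschitz[where K = K] assms(2)) simp_all
  from bchoice[OF this] obtain L where "\<forall>k\<in>{..<m}. L k \<ge> 0 \<and> (\<forall>\<^sub>F \<delta> in at_right 0. ?P k (L k) \<delta>)" ..
  then have L: "\<And>k. k < m \<Longrightarrow> L k \<ge> 0" "\<And>k. k \<in> {..<m} \<Longrightarrow> \<forall>\<^sub>F \<delta> in at_right 0. ?P k (L k) \<delta>"
    by simp_all
  have "\<forall>\<^sub>F \<delta> in at_right 0. \<forall>k\<in>{..<m}. ?P k (L k) \<delta>"
    using L(2) by (intro eventually_ball_finite ballI) auto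
  moreover have "\<forall>\<^sub>F \<delta> in at_right (0::real). \<delta> > 0"
    by (simp add: eventually_at_right_less)
  ultimately have "\<forall>\<^sub>F \<delta> in at_right 0. \<delta> > 0 \<and> (\<forall>k\<in>{..<m}. ?P k (L k) \<delta>)"
    by eventually_elim blast
  then obtain \<delta> where "\<delta> > 0 \<and> (\<forall>k\<in>{..<m}. ?P k (L k) \<delta>)"
    using eventually_happens'[OF trivial_limit_at_right_real] by blast
  then have \<delta>: "\<delta> > 0" "\<And>k. k < m \<Longrightarrow> ?P k (L k) \<delta>"
    by simp_all
  have LS: "L k \<le> (\<Sum>k<m. L k)" if "k < m" for k
    using that L(1) by (intro member_le_sum) auto
  show thesis
  proof (rule that[of "\<Sum>k<m. L k" \<delta>])
    fix t x k assume *: "in_box m \<delta> t0 u0 t x" "k < m"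
    have "L k * (\<Sum>i<m. \<bar>x i - u0 i\<bar>) \<le> (\<Sum>k<m. L k) * (\<Sum>i<m. \<bar>x i - u0 i\<bar>)"
      using LS[OF *(2)] by (intro mult_right_mono sum_nonneg) auto
    then show "\<bar>f t x k - f t u0 k\<bar> \<le> (\<Sum>k<m. L k) * (\<Sum>i<m. \<bar>x i - u0 i\<bar>)"
      using \<delta>(2)[OF *(2)] *(1) by (meson order_trans)
    have "L k * \<bar>t - t0\<bar> \<le> (\<Sum>k<m. L k) * \<bar>t - t0\<bar>"
      using LS[OF *(2)] by (intro mult_right_mono) auto
    then show "\<bar>f t x k - f t0 x k\<bar> \<le> (\<Sum>k<m. L k) * \<bar>t - t0\<bar>"
      using \<delta>(2)[OF *(2)] *(1) by (meson order_trans)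
  qed (use L(1) \<delta>(1) in \<open>auto intro: sum_nonneg\<close>)
qed

section \<open>Inner products in coordinates\<close>

definition unit_vec :: "nat \<Rightarrow> nat \<Rightarrow> real" where
  "unit_vec i = (\<lambda>k. if k = i then 1 else 0)"

text \<open>
  The inner product is only known to be bilinear on \<^term>\<open>Rn m\<close>. Its Gram matrix defines a form
  that agrees with it there but is bilinear on all functions, and whose limits, orders of magnitude
  and derivatives can be read off from the coordinates.
\<close>

definition gram_form :: "nat \<Rightarrow> ((nat \<Rightarrow> real) \<Rightarrow> (nat \<Rightarrow> real) \<Rightarrow> real) \<Rightarrow> (nat \<Rightarrow> real) \<Rightarrow> (nat \<Rightarrow> real) \<Rightarrow> real" where
  "gram_form m ip x y = (\<Sum>i<m. \<Sum>j<m. x i * y j * ip (unit_vec i) (unit_vec j))"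

lemma unit_vec_Rn: "i < m \<Longrightarrow> unit_vec i \<in> Rn m"
  by (simp add: unit_vec_def Rn_iff)

lemma inner_product_expand_left:
  assumes ip: "inner_product_on m ip" and "x \<in> Rn m" "y \<in> Rn m"
  shows "ip x y = (\<Sum>i<m. x i * ip (unit_vec i) y)"
proof -
  have add: "ip (\<lambda>k. v k + w k) y = ip v y + ip w y" if "v \<in> Rn m" "w \<in> Rn m" for v w
    using ip that assms(3) unfolding inner_product_on_def by blast
  have scale: "ip (\<lambda>k. c * v k) y = c * ip v y" if "v \<in> Rn m" for c v
    using ip that assms(3) unfolding inner_product_on_def by blast
  have "ip (\<lambda>k. if k < n then x k else 0) y = (\<Sum>i<n. x i * ip (unit_vec i) y)" if "n \<le> m" for n
    using that
  proof (induction n)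
    case 0
    show ?case
      using scale[OF assms(2), of 0] by simp
  next
    case (Suc n)
    have "(\<lambda>k. if k < Suc n then x k else 0) = (\<lambda>k. (if k < n then x k else 0) + x n * unit_vec n k)"
      by (auto simp: unit_vec_def fun_eq_iff less_Suc_eq)
    moreover have "(\<lambda>k. if k < n then x k else 0) \<in> Rn m" "(\<lambda>k. x n * unit_vec n k) \<in> Rn m"
      using Suc.prems by (auto simp: unit_vec_def Rn_iff)
    ultimately show ?case
      using Suc scale[OF unit_vec_Rn, of n "x n"] add by simp
  qed
  moreover have "(\<lambda>k. if k < m then x k else 0) = x"
    using assms(2) by (auto simp: Rn_iff fun_eq_iff)
  ultimately show ?thesis
    by (metis order_refl)
qed

lemma inner_product_eq_gram_form:
  assumes ip: "inner_product_on m ip" and "x \<in> Rn m" "y \<in> Rn m"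
  shows "ip x y = gram_form m ip x y"
proof -
  have sym: "ip v w = ip w v" if "v \<in> Rn m" "w \<in> Rn m" for v w
    using ip that unfolding inner_product_on_def by blast
  have "ip (unit_vec i) y = (\<Sum>j<m. y j * ip (unit_vec i) (unit_vec j))" if "i < m" for i
  proof -
    have "ip (unit_vec i) y = (\<Sum>j<m. y j * ip (unit_vec j) (unit_vec i))"
      using sym[OF unit_vec_Rn[OF that] assms(3)] inner_product_expand_left[OF ip assms(3) unit_vec_Rn[OF that]]
      by simp
    also have "\<dots> = (\<Sum>j<m. y j * ip (unit_vec i) (unit_vec j))"
      using sym[OF unit_vec_Rn unit_vec_Rn] that by (intro sum.cong) auto
    finally show ?thesis .
  qed
  then show ?thesis
    unfolding inner_product_expand_left[OF assms] gram_form_def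
    by (intro sum.cong) (auto simp: sum_distrib_left mult_ac)
qed

lemma gram_form_cong:
  "(\<And>k. k < m \<Longrightarrow> x k = x' k) \<Longrightarrow> (\<And>k. k < m \<Longrightarrow> y k = y' k) \<Longrightarrow> gram_form m ip x y = gram_form m ip x' y'"
  unfolding gram_form_def by (intro sum.cong) auto

lemma gram_form_commute:
  assumes "inner_product_on m ip"
  shows "gram_form m ip x y = gram_form m ip y x"
proof -
  have "ip (unit_vec i) (unit_vec j) = ip (unit_vec j) (unit_vec i)" if "i < m" "j < m" for i j
    using assms unit_vec_Rn that unfolding inner_product_on_def by blast
  then show ?thesis
    unfolding gram_form_def by (subst sum.swap) (auto intro!: sum.cong)
qed

lemma gram_form_add_left:
  "gram_form m ip (\<lambda>k. x k + c * x' k) y = gram_form m ip x y + c * gram_form m ip x' y"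
  by (simp add: gram_form_def algebra_simps sum.distrib sum_distrib_left)

lemma gram_form_add_right:
  "gram_form m ip x (\<lambda>k. y k + c * y' k) = gram_form m ip x y + c * gram_form m ip x y'"
  by (simp add: gram_form_def algebra_simps sum.distrib sum_distrib_left)

lemma gram_form_sum_left:
  "gram_form m ip (\<lambda>k. \<Sum>j\<in>J. c j * F j k) y = (\<Sum>j\<in>J. c j * gram_form m ip (F j) y)"
proof (induction J rule: infinite_finite_induct)
  case (insert j J)
  then show ?case
    using gram_form_add_left[of m ip "\<lambda>k. \<Sum>j\<in>J. c j * F j k" "c j" "F j" y]
    by (simp add: add.commute)
qed (simp_all add: gram_form_def)

lemma gram_form_tendsto:
  assumes "\<And>k. k < m \<Longrightarrow> ((\<lambda>h. v h k) \<longlongrightarrow> x k) net" "\<And>k. k < m \<Longrightarrow> ((\<lambda>h. w h k) \<longlongrightarrow> y k) net"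
  shows "((\<lambda>h. gram_form m ip (v h) (w h)) \<longlongrightarrow> gram_form m ip x y) net"
  unfolding gram_form_def using assms by (intro tendsto_intros) auto

lemma gram_form_bigo:
  fixes g1 g2 :: "real \<Rightarrow> real"
  assumes "\<And>k. k < m \<Longrightarrow> (\<lambda>h. v h k) \<in> O[net](g1)" "\<And>k. k < m \<Longrightarrow> (\<lambda>h. w h k) \<in> O[net](g2)"
  shows "(\<lambda>h. gram_form m ip (v h) (w h)) \<in> O[net](\<lambda>h. g1 h * g2 h)"
  unfolding gram_form_def
proof (intro big_sum_in_bigo)
  fix i j assume "i \<in> {..<m}" "j \<in> {..<m}"
  then have "(\<lambda>h. v h i * w h j) \<in> O[net](\<lambda>h. g1 h * g2 h)"
    using assms by (intro landau_o.big.mult) auto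
  then have "(\<lambda>h. ip (unit_vec i) (unit_vec j) * (v h i * w h j)) \<in> O[net](\<lambda>h. g1 h * g2 h)"
    by (cases "ip (unit_vec i) (unit_vec j) = 0") simp_all
  then show "(\<lambda>h. v h i * w h j * ip (unit_vec i) (unit_vec j)) \<in> O[net](\<lambda>h. g1 h * g2 h)"
    by (simp add: mult_ac)
qed

lemma ip_norm_bigo:
  fixes g :: "real \<Rightarrow> real"
  assumes "inner_product_on m ip" "\<forall>\<^sub>F h in net. d h \<in> Rn m" "\<And>k. k < m \<Longrightarrow> (\<lambda>h. d h k) \<in> O[net](g)"
  shows "(\<lambda>h. ip_norm ip (d h)) \<in> O[net](g)"
proof -
  have "(\<lambda>h. gram_form m ip (d h) (d h)) \<in> O[net](\<lambda>h. g h * g h)"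
    using assms(3) by (intro gram_form_bigo)
  then obtain c where c: "c > 0" "\<forall>\<^sub>F h in net. norm (gram_form m ip (d h) (d h)) \<le> c * norm (g h * g h)"
    by (elim landau_o.bigE)
  from c(2) assms(2) have "\<forall>\<^sub>F h in net. norm (ip_norm ip (d h)) \<le> sqrt c * norm (g h)"
  proof eventually_elim
    case (elim h)
    then have "\<bar>ip (d h) (d h)\<bar> \<le> c * (\<bar>g h\<bar>)\<^sup>2"
      using inner_product_eq_gram_form[OF assms(1)] by (simp add: power2_eq_square abs_mult)
    then have "sqrt \<bar>ip (d h) (d h)\<bar> \<le> sqrt c * \<bar>g h\<bar>"
      by (metis abs_abs real_sqrt_abs real_sqrt_le_mono real_sqrt_mult)
    then show ?case
      by (simp add: ip_norm_def real_sqrt_abs2 flip: real_sqrt_abs')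
  qed
  then show ?thesis
    by (rule bigoI)
qed

lemma ip_norm_square:
  assumes "inner_product_on m ip" "x \<in> Rn m"
  shows "(ip_norm ip x)\<^sup>2 = ip x x"
proof -
  have "ip x x \<ge> 0"
  proof (cases "x = (\<lambda>_. 0)")
    case True
    have "ip (\<lambda>k. 0 * x k) x = 0 * ip x x"
      using assms unfolding inner_product_on_def by blast
    with True show ?thesis by simp
  next
    case False
    then have "ip x x > 0" using assms unfolding inner_product_on_def by blast
    then show ?thesis by simp
  qed
  then show ?thesis
    by (simp add: ip_norm_def)
qed

section \<open>Orders of magnitude as the step size tends to zero\<close>

lemma bigo_cancel_power:
  fixes g :: "real \<Rightarrow> real"
  assumes "(\<lambda>h. h ^ n * g h) \<in> O[at_right 0](\<lambda>h. h ^ (n + k))"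
  shows "g \<in> O[at_right 0](\<lambda>h. h ^ k)"
proof -
  obtain c where c: "\<forall>\<^sub>F h in at_right 0. norm (h ^ n * g h) \<le> c * norm (h ^ (n + k))"
    using assms by (elim landau_o.bigE)
  have "\<forall>\<^sub>F h in at_right (0::real). h > 0"
    by (simp add: eventually_at_right_less)
  with c have "\<forall>\<^sub>F h in at_right 0. norm (g h) \<le> c * norm (h ^ k)"
  proof eventually_elim
    case (elim h)
    then have "h ^ n * \<bar>g h\<bar> \<le> h ^ n * (c * h ^ k)"
      by (simp add: abs_mult power_add mult_ac)
    with elim(2) show ?case
      by simp
  qed
  then show ?thesis by (rule bigoI)
qed

lemma bigo_power_mono_at_right_0:
  assumes "k \<le> n"
  shows "(\<lambda>h::real. h ^ n) \<in> O[at_right 0](\<lambda>h. h ^ k)"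
proof (rule bigoI[of _ 1])
  have "\<forall>\<^sub>F h in at_right (0::real). 0 < h \<and> h < 1"
    using eventually_at_right_real[of 0 1] by simp
  then show "\<forall>\<^sub>F h in at_right 0. norm (h ^ n :: real) \<le> 1 * norm (h ^ k)"
    by eventually_elim (use assms in \<open>auto intro: power_decreasing\<close>)
qed

lemma bigo_id_tendsto_0:
  fixes g :: "real \<Rightarrow> real"
  assumes "g \<in> O[at_right 0](\<lambda>h. h)"
  shows "(g \<longlongrightarrow> 0) (at_right 0)"
proof -
  obtain c where "\<forall>\<^sub>F h in at_right 0. norm (g h) \<le> c * norm h"
    using assms by (elim landau_o.bigE)
  moreover have "((\<lambda>h::real. c * norm h) \<longlongrightarrow> 0) (at_right 0)"
    by (auto intro!: tendsto_eq_intros)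
  ultimately show ?thesis
    by (rule Lim_null_comparison)
qed

lemma approx_of_order_L2_component:
  assumes "approx_of_order (\<lambda>x. L2_set x {..<m}) q v w" "k < m"
  shows "(\<lambda>h. v h k - w h k) \<in> O[at_right 0](\<lambda>h. h ^ (q + 1))"
proof -
  have "\<bar>v h k - w h k\<bar> \<le> \<bar>L2_set (\<lambda>k. v h k - w h k) {..<m}\<bar>" for h
    using member_le_L2_set[of "{..<m}" k "\<lambda>k. \<bar>v h k - w h k\<bar>"] assms(2)
    by (simp add: L2_set_def)
  then have "(\<lambda>h. v h k - w h k) \<in> O[at_right 0](\<lambda>h. L2_set (\<lambda>k. v h k - w h k) {..<m})"
    by (intro bigoI[of _ 1]) simp
  also have "(\<lambda>h. L2_set (\<lambda>k. v h k - w h k) {..<m}) \<in> O[at_right 0](\<lambda>h. h ^ (q + 1))"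
    using assms(1) unfolding approx_of_order_def .
  finally show ?thesis .
qed

lemma tendsto_shift_at_right_0: "((\<lambda>h. a + c * h :: real) \<longlongrightarrow> a) (at_right 0)"
  by (auto intro!: tendsto_eq_intros)

section \<open>Augmenting the system by its energy\<close>

text \<open>
  The right-hand side of \<open>u' = f(t, u)\<close>, \<open>w' = 2 \<langle>f(t, u), u\<rangle>\<close>, with \<open>w\<close> as the coordinate of index
  \<open>m\<close>. It is a function of \<open>t\<close> and \<open>u\<close> alone: \<open>f\<close> sees the point with this coordinate reset to zero, and
  the form only looks at the first \<open>m\<close> coordinates.
\<close>

definition energy_rhs ::
  "nat \<Rightarrow> ((nat \<Rightarrow> real) \<Rightarrow> (nat \<Rightarrow> real) \<Rightarrow> real) \<Rightarrow> (real \<Rightarrow> (nat \<Rightarrow> real) \<Rightarrow> (nat \<Rightarrow> real)) \<Rightarrow>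
   real \<Rightarrow> (nat \<Rightarrow> real) \<Rightarrow> (nat \<Rightarrow> real)" where
  "energy_rhs m ip f t z = (\<lambda>k. if k < m then f t (z(m := 0)) k
     else if k = m then 2 * gram_form m ip (f t (z(m := 0))) z else 0)"

lemma smooth_energy_rhs:
  assumes "smooth_rhs K m f"
  shows "smooth_rhs K (Suc m) (energy_rhs m ip f)"
  unfolding smooth_rhs_def
proof (intro conjI allI ballI impI)
  have f: "C_diff K (Suc m) (\<lambda>t z. f t (z(m := 0)) k)" if "k < m" for k
    using assms that C_diff_lift[of K m "\<lambda>t x. f t x k"] unfolding smooth_rhs_def by blast
  show "energy_rhs m ip f t z \<in> Rn (Suc m)" for t z
    by (simp add: energy_rhs_def Rn_iff)
  fix k assume "k < Suc m"
  then consider "k < m" | "k = m" by linarith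
  then show "C_diff K (Suc m) (\<lambda>t z. energy_rhs m ip f t z k)"
  proof cases
    case 1
    with f[OF 1] show ?thesis by (simp add: energy_rhs_def)
  next
    case 2
    have "C_diff K (Suc m) (\<lambda>t z. 2 * (\<Sum>i<m. \<Sum>j<m. f t (z(m := 0)) i * z j * ip (unit_vec i) (unit_vec j)))"
      using f by (intro C_diff_mult C_diff_sum C_diff_const C_diff_coord) auto
    with 2 show ?thesis by (simp add: energy_rhs_def gram_form_def)
  qed
qed

lemma gram_form_deriv:
  assumes "inner_product_on m ip" "\<And>k. k < m \<Longrightarrow> ((\<lambda>\<tau>. u \<tau> k) has_real_derivative v k) (at t)"
  shows "((\<lambda>\<tau>. gram_form m ip (u \<tau>) (u \<tau>)) has_real_derivative 2 * gram_form m ip v (u t)) (at t)"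
proof -
  have "((\<lambda>\<tau>. gram_form m ip (u \<tau>) (u \<tau>)) has_real_derivative
     (\<Sum>i<m. \<Sum>j<m. (v i * u t j + v j * u t i) * ip (unit_vec i) (unit_vec j))) (at t)"
    unfolding gram_form_def using assms(2)
    by (intro DERIV_sum DERIV_cmult_right DERIV_mult) auto
  moreover have "(\<Sum>i<m. \<Sum>j<m. (v i * u t j + v j * u t i) * ip (unit_vec i) (unit_vec j))
     = gram_form m ip v (u t) + gram_form m ip (u t) v"
    by (simp add: gram_form_def sum.distrib algebra_simps)
  ultimately show ?thesis
    using gram_form_commute[OF assms(1), of "u t" v] by simp
qed

section \<open>One step of the relaxed method\<close>

text \<open>
  A single step from exact starting data. The order condition is assumed for problems of all
  dimensions, since it is used for the given problem and for the one augmented by the energy. As the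
  condition is for \<open>C\<^sup>K\<close> problems and the given one is \<open>C\<^sup>K\<^sup>+\<^sup>1\<close>, local Lipschitz estimates hold.
\<close>

locale relaxation_step =
  fixes m s p K :: nat and A :: "nat \<Rightarrow> nat \<Rightarrow> real" and b :: "nat \<Rightarrow> real"
    and ip :: "(nat \<Rightarrow> real) \<Rightarrow> (nat \<Rightarrow> real) \<Rightarrow> real"
    and f :: "real \<Rightarrow> (nat \<Rightarrow> real) \<Rightarrow> (nat \<Rightarrow> real)" and t0 :: real
    and u :: "real \<Rightarrow> nat \<Rightarrow> real" and Y :: "real \<Rightarrow> nat \<Rightarrow> nat \<Rightarrow> real"
  assumes p: "p \<ge> 1"
    and order: "\<And>m f t0 u Y. smooth_rhs K m f \<Longrightarrow> solves_ode m f t0 u \<Longrightarrow>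
        rk_stages m s A f t0 (u t0) Y \<Longrightarrow>
        approx_of_order (\<lambda>x. L2_set x {..<m}) p
          (\<lambda>h. rk_update s b (u t0) h (rk_slope s A f t0 Y h)) (\<lambda>h. u (t0 + h))"
    and inner: "inner_product_on m ip"
    and smooth: "smooth_rhs (Suc K) m f"
    and sol: "solves_ode m f t0 u"
    and stages: "rk_stages m s A f t0 (u t0) Y"
begin

abbreviation "u0 \<equiv> u t0"
abbreviation "F \<equiv> rk_slope s A f t0 Y"
abbreviation "X h \<equiv> rk_increment s b (F h)"
abbreviation "B \<equiv> gram_form m ip"
abbreviation "gam h \<equiv> relaxation_gamma s A b ip (F h)"

lemma u_Rn: "\<forall>\<^sub>F t in nhds t0. u t \<in> Rn m"
  using sol unfolding solves_ode_def by (rule eventually_mono) blast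

lemma u0_Rn: "u0 \<in> Rn m"
  using u_Rn by (rule eventually_nhds_x_imp_x)

lemma u_deriv: "\<forall>\<^sub>F t in nhds t0. \<forall>k<m. ((\<lambda>\<tau>. u \<tau> k) has_real_derivative f t (u t) k) (at t)"
  using sol unfolding solves_ode_def by (rule eventually_mono) blast

lemma u_deriv_start: "k < m \<Longrightarrow> ((\<lambda>\<tau>. u \<tau> k) has_real_derivative f t0 u0 k) (at t0)"
  using eventually_nhds_x_imp_x[OF u_deriv] by blast

lemma Y_Rn: "\<forall>\<^sub>F h in at_right 0. \<forall>i<s. Y h i \<in> Rn m"
  using stages unfolding rk_stages_def by (auto elim: eventually_mono)

lemma Y_eq: "\<forall>\<^sub>F h in at_right 0. \<forall>i<s. Y h i = (\<lambda>k. u0 k + h * (\<Sum>j<s. A i j * F h j k))"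
  using stages unfolding rk_stages_def by (auto elim: eventually_mono)

lemma Y_tendsto: "i < s \<Longrightarrow> ((\<lambda>h. Y h i k) \<longlongrightarrow> u0 k) (at_right 0)"
  using stages unfolding rk_stages_def tendsto_fun_iff by blast

lemma F_Rn: "\<forall>\<^sub>F h in at_right 0. \<forall>i<s. F h i \<in> Rn m"
  using Y_Rn
proof eventually_elim
  case (elim h)
  then show ?case
    using smooth unfolding smooth_rhs_def rk_slope_def by blast
qed

lemma X_Rn: "\<forall>\<^sub>F h in at_right 0. X h \<in> Rn m"
  using F_Rn by eventually_elim (simp add: rk_increment_def Rn_iff)

lemma F_tendsto:
  assumes "j < s" "k < m"
  shows "((\<lambda>h. F h j k) \<longlongrightarrow> f t0 u0 k) (at_right 0)"
proof -
  have c: "continuous_on (UNIV \<times> Rn m) (\<lambda>(t, x). f t x k)"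
    using smooth assms(2) C_diff_continuous unfolding smooth_rhs_def by blast
  have "((\<lambda>h. (t0 + rk_node s A j * h, Y h j)) \<longlongrightarrow> (t0, u0)) (at_right 0)"
    using Y_tendsto[OF assms(1)]
    by (intro tendsto_Pair tendsto_shift_at_right_0) (simp add: tendsto_fun_iff)
  moreover have "\<forall>\<^sub>F h in at_right 0. (t0 + rk_node s A j * h, Y h j) \<in> UNIV \<times> Rn m"
    using Y_Rn by eventually_elim (use assms(1) in auto)
  ultimately show ?thesis
    using continuous_on_tendsto_compose[OF c, of "\<lambda>h. (t0 + rk_node s A j * h, Y h j)" "(t0, u0)" "at_right 0"] u0_Rn
    by (simp add: rk_slope_def)
qed

lemma increment_error:
  assumes "k < m"
  shows "(\<lambda>h. u0 k + h * X h k - u (t0 + h) k) \<in> O[at_right 0](\<lambda>h. h ^ (p + 1))"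
  using approx_of_order_L2_component[OF order[OF smooth_rhs_mono[OF smooth] sol stages] assms]
  by (simp add: rk_update_def)

text \<open>
  The \<open>w\<close>-component of the order condition for the augmented system. Its exact solution is
  \<open>w = \<parallel>u\<parallel>\<^sup>2\<close>. Its stages are those of the given system, completed by the \<open>w\<close>-components that the
  stage equations prescribe: these are explicit, the right-hand side being a function of \<open>t\<close> and \<open>u\<close> alone.
\<close>

lemma energy_error:
  "(\<lambda>h. B u0 u0 + h * (\<Sum>j<s. b j * (2 * B (F h j) (Y h j))) - B (u (t0 + h)) (u (t0 + h)))
     \<in> O[at_right 0](\<lambda>h. h ^ (p + 1))"
proof -
  let ?f = "energy_rhs m ip f"
  define u' where "u' t = (u t)(m := B (u t) (u t))" for t
  define Y' where "Y' h i = (Y h i)(m := B u0 u0 + h * (\<Sum>j<s. A i j * (2 * B (F h j) (Y h j))))" for h i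
  have B_upd: "B (x(m := c)) y = B x y" "B x (y(m := c)) = B x y" for x y c
    by (auto intro: gram_form_cong)
  have reset: "(x(m := c))(m := 0) = x" if "x \<in> Rn m" for x and c :: real
    using that by (auto simp: Rn_iff fun_eq_iff)
  have slope: "\<forall>\<^sub>F h in at_right 0. \<forall>j<s. rk_slope s A ?f t0 Y' h j = (F h j)(m := 2 * B (F h j) (Y h j))"
    using Y_Rn F_Rn
  proof eventually_elim
    case (elim h)
    then show ?case
      by (auto simp: rk_slope_def energy_rhs_def Y'_def reset B_upd Rn_iff fun_eq_iff simp del: fun_upd_upd)
  qed
  have "solves_ode (Suc m) ?f t0 u'"
    unfolding solves_ode_def using u_Rn u_deriv
  proof eventually_elim
    case (elim t)
    show ?case
    proof (intro conjI allI impI)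
      show "u' t \<in> Rn (Suc m)"
        using elim(1) by (simp add: u'_def Rn_iff)
      fix k assume "k < Suc m"
      then consider "k < m" | "k = m" by linarith
      then show "((\<lambda>\<tau>. u' \<tau> k) has_real_derivative ?f t (u' t) k) (at t)"
      proof cases
        case 1
        with elim(2) show ?thesis
          by (simp add: u'_def energy_rhs_def reset[OF elim(1), simplified])
      next
        case 2
        have "((\<lambda>\<tau>. B (u \<tau>) (u \<tau>)) has_real_derivative 2 * B (f t (u t)) (u t)) (at t)"
          using elim(2) by (intro gram_form_deriv inner) auto
        with 2 show ?thesis
          by (simp add: u'_def energy_rhs_def reset[OF elim(1), simplified] B_upd)
      qed
    qed
  qed
  moreover have "rk_stages (Suc m) s A ?f t0 (u' t0) Y'"
    unfolding rk_stages_def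
  proof (intro conjI allI impI)
    show "\<forall>\<^sub>F h in at_right 0. \<forall>i<s. Y' h i \<in> Rn (Suc m) \<and>
        Y' h i = (\<lambda>k. u' t0 k + h * (\<Sum>j<s. A i j * rk_slope s A ?f t0 Y' h j k))"
      using slope Y_Rn Y_eq
    proof eventually_elim
      case (elim h)
      show ?case
      proof (intro allI impI conjI)
        fix i assume i: "i < s"
        show "Y' h i \<in> Rn (Suc m)"
          using elim(2) i by (simp add: Y'_def Rn_iff)
        have "(\<Sum>j<s. A i j * rk_slope s A ?f t0 Y' h j k)
            = (\<Sum>j<s. A i j * ((F h j)(m := 2 * B (F h j) (Y h j))) k)" for k
          using elim(1) by (intro sum.cong) auto
        moreover have "Y h i k = u0 k + h * (\<Sum>j<s. A i j * F h j k)" for k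
          using elim(3) i by metis
        ultimately show "Y' h i = (\<lambda>k. u' t0 k + h * (\<Sum>j<s. A i j * rk_slope s A ?f t0 Y' h j k))"
          by (auto simp: Y'_def u'_def fun_eq_iff)
      qed
    qed
    fix i assume i: "i < s"
    have "((\<lambda>h. B u0 u0 + h * (\<Sum>j<s. A i j * (2 * B (F h j) (Y h j)))) \<longlongrightarrow>
       B u0 u0 + 0 * (\<Sum>j<s. A i j * (2 * B (f t0 u0) u0))) (at_right 0)"
      by (intro tendsto_intros gram_form_tendsto F_tendsto Y_tendsto) auto
    then show "((\<lambda>h. Y' h i) \<longlongrightarrow> u' t0) (at_right 0)"
      using Y_tendsto[OF i] by (auto simp: tendsto_fun_iff Y'_def u'_def)
  qed
  ultimately have "(\<lambda>h. rk_update s b (u' t0) h (rk_slope s A ?f t0 Y' h) m - u' (t0 + h) m)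
      \<in> O[at_right 0](\<lambda>h. h ^ (p + 1))"
    by (intro approx_of_order_L2_component[OF order[OF smooth_energy_rhs[OF smooth_rhs_mono[OF smooth]]]]) auto
  moreover have "\<forall>\<^sub>F h in at_right 0. rk_update s b (u' t0) h (rk_slope s A ?f t0 Y' h) m - u' (t0 + h) m
     = B u0 u0 + h * (\<Sum>j<s. b j * (2 * B (F h j) (Y h j))) - B (u (t0 + h)) (u (t0 + h))"
    using slope by eventually_elim (simp add: rk_update_def rk_increment_def u'_def)
  ultimately show ?thesis
    by (simp add: landau_o.big.in_cong)
qed

text \<open>
  Up to sign the numerator of \<open>\<gamma> - 1\<close>.
\<close>

abbreviation "defect h \<equiv> B (X h) (X h) - 2 * (\<Sum>i<s. \<Sum>j<s. b i * A i j * B (F h i) (F h j))"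

lemma B_increment_left: "B (X h) y = (\<Sum>i<s. b i * B (F h i) y)"
  by (simp only: rk_increment_def gram_form_sum_left)

text \<open>
  Expanding the square of the updated value leaves \<open>2 h \<langle>u0, X\<rangle> + h\<^sup>2 \<parallel>X\<parallel>\<^sup>2\<close> besides \<open>\<parallel>u0\<parallel>\<^sup>2\<close>. The
  stage equations turn each \<open>\<langle>f i, u0\<rangle>\<close> in it into \<open>\<langle>f i, y i\<rangle> - h \<Sum>j a i j \<langle>f i, f j\<rangle>\<close>.
\<close>

lemma energy_identity:
  "\<forall>\<^sub>F h in at_right 0. h\<^sup>2 * defect h = B (\<lambda>k. u0 k + h * X h k) (\<lambda>k. u0 k + h * X h k)
     - (B u0 u0 + h * (\<Sum>j<s. b j * (2 * B (F h j) (Y h j))))"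
  using Y_eq
proof eventually_elim
  case (elim h)
  have "B (F h i) (Y h i) = B (F h i) u0 + h * (\<Sum>j<s. A i j * B (F h i) (F h j))" if "i < s" for i
  proof -
    have "B (F h i) (Y h i) = B (F h i) (\<lambda>k. u0 k + h * (\<Sum>j<s. A i j * F h j k))"
      using elim that by (intro gram_form_cong) metis+
    also have "\<dots> = B (F h i) u0 + h * B (F h i) (\<lambda>k. \<Sum>j<s. A i j * F h j k)"
      by (rule gram_form_add_right)
    also have "B (F h i) (\<lambda>k. \<Sum>j<s. A i j * F h j k) = (\<Sum>j<s. A i j * B (F h j) (F h i))"
      by (simp only: gram_form_commute[OF inner, of "F h i"] gram_form_sum_left)
    finally show ?thesis
      by (simp add: gram_form_commute[OF inner, of "F h i"])
  qed
  then have "(\<Sum>i<s. b i * (2 * B (F h i) (Y h i)))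
      = (\<Sum>i<s. 2 * (b i * B (F h i) u0) + 2 * h * (\<Sum>j<s. b i * A i j * B (F h i) (F h j)))"
    by (intro sum.cong) (auto simp: algebra_simps sum_distrib_left)
  also have "\<dots> = 2 * B (X h) u0 + 2 * h * (\<Sum>i<s. \<Sum>j<s. b i * A i j * B (F h i) (F h j))"
    by (simp add: B_increment_left sum.distrib sum_distrib_left)
  finally have stage_energy: "(\<Sum>i<s. b i * (2 * B (F h i) (Y h i)))
      = 2 * B (X h) u0 + 2 * h * (\<Sum>i<s. \<Sum>j<s. b i * A i j * B (F h i) (F h j))" .
  have "B (\<lambda>k. u0 k + h * X h k) (\<lambda>k. u0 k + h * X h k)
      = B u0 u0 + h * B u0 (X h) + h * (B (X h) u0 + h * B (X h) (X h))"
    by (simp only: gram_form_add_left gram_form_add_right)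
  also have "B u0 (X h) = B (X h) u0"
    by (rule gram_form_commute[OF inner])
  finally show ?case
    unfolding stage_energy by (simp add: algebra_simps power2_eq_square)
qed

lemma gamma_defect:
  "\<forall>\<^sub>F h in at_right 0. gam h - 1 = (if B (X h) (X h) = 0 then 0 else - defect h / B (X h) (X h))"
  using F_Rn X_Rn
proof eventually_elim
  case (elim h)
  have ip: "ip (F h i) (F h j) = B (F h i) (F h j)" if "i < s" "j < s" for i j
    using elim that by (intro inner_product_eq_gram_form inner) auto
  have num: "(\<Sum>i<s. \<Sum>j<s. c i j * ip (F h i) (F h j)) = (\<Sum>i<s. \<Sum>j<s. c i j * B (F h i) (F h j))" for c
    using ip by (intro sum.cong) auto
  have "B (F h i) (X h) = (\<Sum>j<s. b j * B (F h i) (F h j))" for i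
    by (simp only: gram_form_commute[OF inner, of "F h i"] B_increment_left)
  then have den: "B (X h) (X h) = (\<Sum>i<s. \<Sum>j<s. b i * b j * B (F h i) (F h j))"
    by (simp add: B_increment_left[of h "X h"] sum_distrib_left mult_ac)
  have "(ip_norm ip (X h))\<^sup>2 = B (X h) (X h)"
    using ip_norm_square[OF inner elim(2)] inner_product_eq_gram_form[OF inner elim(2) elim(2)] by simp
  then show ?case
    unfolding relaxation_gamma_def num den by (auto simp: field_simps)
qed

lemma solution_Lipschitz:
  "\<exists>c\<ge>0. \<forall>\<^sub>F t in nhds t0. \<forall>k<m. \<bar>u t k - u0 k\<bar> \<le> c * \<bar>t - t0\<bar>"
proof -
  \<comment> \<open>near \<open>t0\<close> each difference quotient is within 1 of the derivative\<close>
  define c where "c = (\<Sum>k<m. \<bar>f t0 u0 k\<bar> + 1)"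
  have "\<forall>\<^sub>F t in nhds t0. \<bar>u t k - u0 k\<bar> \<le> c * \<bar>t - t0\<bar>" if "k < m" for k
  proof -
    have ck: "\<bar>f t0 u0 k\<bar> + 1 \<le> c"
      unfolding c_def using that by (intro member_le_sum) auto
    have "((\<lambda>t. (u t k - u0 k) / (t - t0)) \<longlongrightarrow> f t0 u0 k) (at t0)"
      using u_deriv_start[OF that] by (simp add: has_field_derivative_iff)
    then have "\<forall>\<^sub>F t in at t0. dist ((u t k - u0 k) / (t - t0)) (f t0 u0 k) < 1"
      by (rule tendstoD) simp
    moreover have "\<forall>\<^sub>F t in at t0. t \<noteq> t0"
      by (simp add: eventually_at_filter)
    ultimately have "\<forall>\<^sub>F t in at t0. \<bar>u t k - u0 k\<bar> \<le> c * \<bar>t - t0\<bar>"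
    proof eventually_elim
      case (elim t)
      then have "\<bar>(u t k - u0 k) / (t - t0)\<bar> \<le> c"
        using ck unfolding dist_real_def by linarith
      with elim show ?case
        by (simp add: abs_divide field_simps)
    qed
    then show ?thesis
      by (simp add: eventually_nhds_conv_at)
  qed
  then have "\<forall>\<^sub>F t in nhds t0. \<forall>k\<in>{..<m}. \<bar>u t k - u0 k\<bar> \<le> c * \<bar>t - t0\<bar>"
    by (intro eventually_ball_finite) auto
  moreover have "c \<ge> 0"
    unfolding c_def by (intro sum_nonneg) auto
  ultimately show ?thesis
    by (intro exI[of _ c]) (simp add: Ball_def)
qed

lemma solution_slope_Lipschitz:
  "\<exists>c\<ge>0. \<forall>\<^sub>F t in nhds t0. \<forall>k<m. \<bar>f t (u t) k - f t0 u0 k\<bar> \<le> c * \<bar>t - t0\<bar>"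
proof -
  obtain L \<delta> where L: "L \<ge> 0" "\<delta> > 0"
    "\<And>t x k. in_box m \<delta> t0 u0 t x \<Longrightarrow> k < m \<Longrightarrow> \<bar>f t x k - f t u0 k\<bar> \<le> L * (\<Sum>i<m. \<bar>x i - u0 i\<bar>)"
    "\<And>t x k. in_box m \<delta> t0 u0 t x \<Longrightarrow> k < m \<Longrightarrow> \<bar>f t x k - f t0 x k\<bar> \<le> L * \<bar>t - t0\<bar>"
    using smooth_rhs_locally_Lipschitz[OF smooth u0_Rn, of t0] by blast
  obtain c where c: "c \<ge> 0" "\<forall>\<^sub>F t in nhds t0. \<forall>k<m. \<bar>u t k - u0 k\<bar> \<le> c * \<bar>t - t0\<bar>"
    using solution_Lipschitz by blast
  have "((\<lambda>t. (c + 1) * \<bar>t - t0\<bar>) \<longlongrightarrow> (c + 1) * \<bar>t0 - t0\<bar>) (nhds t0)"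
    by (intro tendsto_intros filterlim_ident)
  then have "\<forall>\<^sub>F t in nhds t0. (c + 1) * \<bar>t - t0\<bar> < \<delta>"
    using order_tendstoD(2)[of _ _ _ \<delta>] L(2) by simp
  with c(2) u_Rn have "\<forall>\<^sub>F t in nhds t0. \<forall>k<m. \<bar>f t (u t) k - f t0 u0 k\<bar> \<le> (L * (m * c) + L) * \<bar>t - t0\<bar>"
  proof eventually_elim
    case (elim t)
    have "c * \<bar>t - t0\<bar> < \<delta>" "\<bar>t - t0\<bar> < \<delta>"
      using elim(3) mult_nonneg_nonneg[OF c(1), of "\<bar>t - t0\<bar>"]
      unfolding distrib_right mult_1 by linarith+
    then have box: "in_box m \<delta> t0 u0 t (u t)" "in_box m \<delta> t0 u0 t0 (u t)"
      using elim(1,2) L(2) by (fastforce simp: in_box_def)+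
    have "(\<Sum>i<m. \<bar>u t i - u0 i\<bar>) \<le> (\<Sum>i<m. c * \<bar>t - t0\<bar>)"
      using elim(1) by (intro sum_mono) auto
    then have "L * (\<Sum>i<m. \<bar>u t i - u0 i\<bar>) \<le> L * (m * (c * \<bar>t - t0\<bar>))"
      using L(1) by (intro mult_left_mono) simp_all
    then show ?case
      using L(3)[OF box(2)] L(4)[OF box(1)] by (fastforce simp: algebra_simps abs_le_iff)
  qed
  then show ?thesis
    using L(1) c(1) by (intro exI[of _ "L * (m * c) + L"]) auto
qed

text \<open>
  The derivative of \<open>u(t) - t f(t0, u0)\<close> is \<open>O(t - t0)\<close>. Both \<open>h\<close> and \<open>h'\<close> may have either sign,
  because \<open>\<gamma>\<close> may be negative when \<open>p = 1\<close>.
\<close>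

lemma solution_increment:
  "\<exists>c\<ge>0. \<exists>r>0. \<forall>h h'. \<forall>k<m. \<bar>h\<bar> < r \<longrightarrow> \<bar>h'\<bar> < r \<longrightarrow>
     \<bar>u (t0 + h) k - u (t0 + h') k - (h - h') * f t0 u0 k\<bar> \<le> c * (\<bar>h\<bar> + \<bar>h'\<bar>) * \<bar>h - h'\<bar>"
proof -
  obtain c where c: "c \<ge> 0" "\<forall>\<^sub>F t in nhds t0. \<forall>k<m. \<bar>f t (u t) k - f t0 u0 k\<bar> \<le> c * \<bar>t - t0\<bar>"
    using solution_slope_Lipschitz by blast
  obtain r where r: "r > 0" "\<And>t. dist t t0 < r \<Longrightarrow> \<forall>k<m. \<bar>f t (u t) k - f t0 u0 k\<bar> \<le> c * \<bar>t - t0\<bar>"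
    "\<And>t. dist t t0 < r \<Longrightarrow> \<forall>k<m. ((\<lambda>\<tau>. u \<tau> k) has_real_derivative f t (u t) k) (at t)"
    using eventually_conj[OF c(2) u_deriv] unfolding eventually_nhds_metric by blast
  have "\<bar>u (t0 + h) k - u (t0 + h') k - (h - h') * f t0 u0 k\<bar> \<le> c * (\<bar>h\<bar> + \<bar>h'\<bar>) * \<bar>h - h'\<bar>"
    if "k < m" "\<bar>h\<bar> < r" "\<bar>h'\<bar> < r" for h h' k
  proof -
    have "norm ((u (t0 + h) k - (t0 + h) * f t0 u0 k) - (u (t0 + h') k - (t0 + h') * f t0 u0 k))
        \<le> c * (\<bar>h\<bar> + \<bar>h'\<bar>) * norm ((t0 + h) - (t0 + h'))"
    proof (rule field_differentiable_bound[where S = "closed_segment (t0 + h') (t0 + h)"])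
      fix t assume "t \<in> closed_segment (t0 + h') (t0 + h)"
      then have t: "\<bar>t - t0\<bar> \<le> max \<bar>h\<bar> \<bar>h'\<bar>"
        by (auto simp: closed_segment_eq_real_ivl split: if_splits)
      then have "dist t t0 < r"
        using that by (simp add: dist_real_def)
      note rr = r(2)[OF this, rule_format, OF \<open>k < m\<close>] r(3)[OF this, rule_format, OF \<open>k < m\<close>]
      have "c * \<bar>t - t0\<bar> \<le> c * (\<bar>h\<bar> + \<bar>h'\<bar>)"
        using t c(1) by (intro mult_left_mono) auto
      with rr(1) show "norm (f t (u t) k - f t0 u0 k) \<le> c * (\<bar>h\<bar> + \<bar>h'\<bar>)"
        by simp
      show "((\<lambda>t. u t k - t * f t0 u0 k) has_real_derivative f t (u t) k - f t0 u0 k)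
          (at t within closed_segment (t0 + h') (t0 + h))"
        using has_field_derivative_at_within[OF rr(2)] by (auto intro!: derivative_eq_intros)
    qed auto
    then show ?thesis
      by (simp add: algebra_simps)
  qed
  with c(1) r(1) show ?thesis
    by blast
qed

text \<open>
  Consistency does not come from order conditions on the weights but from comparing
  the update with the solution: they differ by \<open>O(h\<^sup>p\<^sup>+\<^sup>1)\<close>, which is \<open>O(h\<^sup>2)\<close> as \<open>p \<ge> 1\<close>, and the
  solution moves by \<open>h f(t0, u0) + O(h\<^sup>2)\<close>.
\<close>

lemma increment_consistent:
  assumes "k < m"
  shows "(\<lambda>h. X h k - f t0 u0 k) \<in> O[at_right 0](\<lambda>h. h)"
proof -
  obtain c r where c: "c \<ge> 0" "r > 0" and cr: "\<And>h h' k. k < m \<Longrightarrow> \<bar>h\<bar> < r \<Longrightarrow> \<bar>h'\<bar> < r \<Longrightarrow>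
     \<bar>u (t0 + h) k - u (t0 + h') k - (h - h') * f t0 u0 k\<bar> \<le> c * (\<bar>h\<bar> + \<bar>h'\<bar>) * \<bar>h - h'\<bar>"
    using solution_increment by blast
  have "\<forall>\<^sub>F h in at_right (0::real). 0 < h \<and> h < r"
    using eventually_at_right_real[of 0 r] c by simp
  then have "\<forall>\<^sub>F h in at_right 0. norm (u (t0 + h) k - u0 k - h * f t0 u0 k) \<le> c * norm (h ^ 2)"
  proof eventually_elim
    case (elim h)
    then show ?case
      using cr[OF assms, of h 0] c by (simp add: power2_eq_square mult_ac)
  qed
  then have "(\<lambda>h. u (t0 + h) k - u0 k - h * f t0 u0 k) \<in> O[at_right 0](\<lambda>h. h ^ 2)"
    by (rule bigoI)
  moreover have "(\<lambda>h. u0 k + h * X h k - u (t0 + h) k) \<in> O[at_right 0](\<lambda>h. h ^ 2)"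
    using p by (intro landau_o.big_trans[OF increment_error[OF assms]] bigo_power_mono_at_right_0) simp
  ultimately have "(\<lambda>h. (u (t0 + h) k - u0 k - h * f t0 u0 k) + (u0 k + h * X h k - u (t0 + h) k))
      \<in> O[at_right 0](\<lambda>h. h ^ 2)"
    by (rule sum_in_bigo)
  then have "(\<lambda>h. h ^ 1 * (X h k - f t0 u0 k)) \<in> O[at_right 0](\<lambda>h. h ^ (1 + 1))"
    by (simp add: algebra_simps power2_eq_square)
  from bigo_cancel_power[OF this] show ?thesis
    by simp
qed

lemma increment_tendsto:
  assumes "k < m"
  shows "((\<lambda>h. X h k) \<longlongrightarrow> f t0 u0 k) (at_right 0)"
  using bigo_id_tendsto_0[OF increment_consistent[OF assms]] by (rule LIM_zero_cancel)

text \<open>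
  By \<open>energy_identity\<close>, \<open>h\<^sup>2\<close> times the defect is the difference of two approximations of
  \<open>\<parallel>u(t0 + h)\<parallel>\<^sup>2\<close>. For the one by \<open>\<parallel>u1\<parallel>\<^sup>2\<close> the error is
  \<open>\<parallel>u1\<parallel>\<^sup>2 - \<parallel>u\<parallel>\<^sup>2 = \<langle>u1 - u, u1\<rangle> + \<langle>u, u1 - u\<rangle>\<close>.
\<close>

lemma defect_bigo: "defect \<in> O[at_right 0](\<lambda>h. h ^ (p - 1))"
proof -
  let ?v = "\<lambda>h k. u0 k + h * X h k" and ?e = "\<lambda>h k. u0 k + h * X h k - u (t0 + h) k"
  have v1: "(\<lambda>h. ?v h k) \<in> O[at_right 0](\<lambda>_. 1)" if "k < m" for k
  proof -
    have "((\<lambda>h. ?v h k) \<longlongrightarrow> u0 k + 0 * f t0 u0 k) (at_right 0)"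
      using increment_tendsto[OF that] by (intro tendsto_intros)
    then show ?thesis
      by (intro bigoI_tendsto) auto
  qed
  have u1: "(\<lambda>h. u (t0 + h) k) \<in> O[at_right 0](\<lambda>_. 1)" if "k < m" for k
  proof -
    have "(\<lambda>h. ?e h k) \<in> O[at_right 0](\<lambda>_. 1)"
      using increment_error[OF that] bigo_power_mono_at_right_0[of 0 "p + 1"] by (simp add: landau_o.big_trans)
    from sum_in_bigo(2)[OF v1[OF that] this] show ?thesis
      by simp
  qed
  have "(\<lambda>h. B (?e h) (?v h)) \<in> O[at_right 0](\<lambda>h. h ^ (p + 1) * 1)"
    by (intro gram_form_bigo increment_error v1)
  moreover have "(\<lambda>h. B (u (t0 + h)) (?e h)) \<in> O[at_right 0](\<lambda>h. 1 * h ^ (p + 1))"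
    by (intro gram_form_bigo increment_error u1)
  ultimately have "(\<lambda>h. B (?e h) (?v h) + B (u (t0 + h)) (?e h)) \<in> O[at_right 0](\<lambda>h. h ^ (p + 1))"
    by (intro sum_in_bigo) simp_all
  from sum_in_bigo(2)[OF this energy_error]
  have "(\<lambda>h. (B (?e h) (?v h) + B (u (t0 + h)) (?e h)) -
      (B u0 u0 + h * (\<Sum>j<s. b j * (2 * B (F h j) (Y h j))) - B (u (t0 + h)) (u (t0 + h))))
    \<in> O[at_right 0](\<lambda>h. h ^ (p + 1))" .
  moreover have "\<forall>\<^sub>F h in at_right 0. (B (?e h) (?v h) + B (u (t0 + h)) (?e h)) -
      (B u0 u0 + h * (\<Sum>j<s. b j * (2 * B (F h j) (Y h j))) - B (u (t0 + h)) (u (t0 + h))) = h ^ 2 * defect h"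
    using energy_identity
  proof eventually_elim
    case (elim h)
    have "B (?e h) (?v h) = B (?v h) (?v h) - B (u (t0 + h)) (?v h)"
      using gram_form_add_left[of m ip "?v h" "-1" "u (t0 + h)" "?v h"] by simp
    moreover have "B (u (t0 + h)) (?e h) = B (u (t0 + h)) (?v h) - B (u (t0 + h)) (u (t0 + h))"
      using gram_form_add_right[of m ip "u (t0 + h)" "?v h" "-1" "u (t0 + h)"] by simp
    ultimately show ?case
      using elim by simp
  qed
  ultimately have "(\<lambda>h. h ^ 2 * defect h) \<in> O[at_right 0](\<lambda>h. h ^ (p + 1))"
    by (simp add: landau_o.big.in_cong)
  then show ?thesis
    using p bigo_cancel_power[of 2 defect "p - 1"] by simp
qed

lemma gamma_bigo_nonzero_slope:
  assumes "f t0 u0 \<noteq> (\<lambda>_. 0)"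
  shows "(\<lambda>h. gam h - 1) \<in> O[at_right 0](\<lambda>h. h ^ (p - 1))"
proof -
  have "f t0 u0 \<in> Rn m"
    using smooth u0_Rn unfolding smooth_rhs_def by blast
  then have pos: "B (f t0 u0) (f t0 u0) > 0"
    using inner assms inner_product_eq_gram_form[OF inner] unfolding inner_product_on_def by metis
  define \<beta> where "\<beta> = B (f t0 u0) (f t0 u0) / 2"
  have "((\<lambda>h. B (X h) (X h)) \<longlongrightarrow> B (f t0 u0) (f t0 u0)) (at_right 0)"
    by (intro gram_form_tendsto increment_tendsto)
  then have "\<forall>\<^sub>F h in at_right 0. \<beta> < B (X h) (X h)"
    using pos by (intro order_tendstoD(1)) (auto simp: \<beta>_def)
  with gamma_defect have "\<forall>\<^sub>F h in at_right 0. norm (gam h - 1) \<le> (1 / \<beta>) * norm (defect h)"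
  proof eventually_elim
    case (elim h)
    have "\<beta> > 0" using pos by (simp add: \<beta>_def)
    with elim(2) have "\<bar>defect h\<bar> / B (X h) (X h) \<le> \<bar>defect h\<bar> / \<beta>"
      by (intro divide_left_mono) auto
    moreover have "\<bar>gam h - 1\<bar> = \<bar>defect h\<bar> / B (X h) (X h)"
      using elim \<open>\<beta> > 0\<close> by (simp del: abs_divide add: abs_divide)
    ultimately show ?case by simp
  qed
  then have "(\<lambda>h. gam h - 1) \<in> O[at_right 0](defect)"
    by (rule bigoI)
  from landau_o.big_trans[OF this defect_bigo] show ?thesis .
qed

text \<open>
  The distances of the stages from \<open>u0\<close> add up to some \<open>e\<close>. Since \<open>f\<close> vanishes at \<open>u0\<close> and is
  Lipschitz, all slopes are \<open>O(e)\<close>, and the stage equations give \<open>e \<le> h C e\<close>. Hence \<open>e = 0\<close> as soon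
  as \<open>h C < 1\<close>.
\<close>

lemma slopes_vanish_if_stationary:
  assumes zero: "\<forall>\<^sub>F t in nhds t0. f t u0 = (\<lambda>_. 0)"
  shows "\<forall>\<^sub>F h in at_right 0. \<forall>j<s. \<forall>k<m. F h j k = 0"
proof -
  obtain L \<delta> where L: "L \<ge> 0" "\<delta> > 0"
    "\<And>t x k. in_box m \<delta> t0 u0 t x \<Longrightarrow> k < m \<Longrightarrow> \<bar>f t x k - f t u0 k\<bar> \<le> L * (\<Sum>i<m. \<bar>x i - u0 i\<bar>)"
    "\<And>t x k. in_box m \<delta> t0 u0 t x \<Longrightarrow> k < m \<Longrightarrow> \<bar>f t x k - f t0 x k\<bar> \<le> L * \<bar>t - t0\<bar>"
    using smooth_rhs_locally_Lipschitz[OF smooth u0_Rn, of t0] by blast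
  have node: "((\<lambda>h. t0 + rk_node s A j * h) \<longlongrightarrow> t0) (at_right 0)" for j
    by (rule tendsto_shift_at_right_0)
  have "\<forall>\<^sub>F h in at_right 0. \<forall>j\<in>{..<s}. f (t0 + rk_node s A j * h) u0 = (\<lambda>_. 0)"
    using eventually_compose_filterlim[OF zero node] by (intro eventually_ball_finite) auto
  moreover have "\<forall>\<^sub>F h in at_right 0. \<forall>j\<in>{..<s}. dist (t0 + rk_node s A j * h) t0 < \<delta>"
    using tendstoD[OF node L(2)] by (intro eventually_ball_finite) auto
  moreover have "\<forall>\<^sub>F h in at_right 0. \<forall>j\<in>{..<s}. \<forall>k\<in>{..<m}. dist (Y h j k) (u0 k) < \<delta>"
    using tendstoD[OF Y_tendsto L(2)] by (intro eventually_ball_finite ballI finite_lessThan) simp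
  ultimately have slope_bound: "\<forall>\<^sub>F h in at_right 0. \<forall>j<s. \<forall>k<m. \<bar>F h j k\<bar> \<le> L * (\<Sum>i<m. \<bar>Y h j i - u0 i\<bar>)"
    using Y_Rn
  proof eventually_elim
    case (elim h)
    show ?case
    proof (intro allI impI)
      fix j k assume jk: "j < s" "k < m"
      have "in_box m \<delta> t0 u0 (t0 + rk_node s A j * h) (Y h j)"
        using elim jk(1) by (auto simp: in_box_def dist_real_def)
      from L(3)[OF this jk(2)] show "\<bar>F h j k\<bar> \<le> L * (\<Sum>i<m. \<bar>Y h j i - u0 i\<bar>)"
        using elim(1) jk(1) by (simp add: rk_slope_def)
    qed
  qed
  define a where "a = (\<Sum>i<s. \<Sum>j<s. \<bar>A i j\<bar>)"
  define C where "C = real s * (real m * (a * L))"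
  have "((\<lambda>h. h * C) \<longlongrightarrow> 0 * C) (at_right 0)"
    by (intro tendsto_intros)
  then have "\<forall>\<^sub>F h in at_right 0. h * C < 1"
    by (rule order_tendstoD) simp
  moreover have "\<forall>\<^sub>F h in at_right (0::real). h > 0"
    by (simp add: eventually_at_right_less)
  ultimately show ?thesis
    using slope_bound Y_eq
  proof eventually_elim
    case (elim h)
    define e where "e = (\<Sum>j<s. \<Sum>k<m. \<bar>Y h j k - u0 k\<bar>)"
    have d_le: "(\<Sum>k<m. \<bar>Y h j k - u0 k\<bar>) \<le> e" if "j < s" for j
      unfolding e_def using that
      by (intro member_le_sum[of j "{..<s}" "\<lambda>j. \<Sum>k<m. \<bar>Y h j k - u0 k\<bar>"] sum_nonneg) auto
    have F_le: "\<bar>F h j k\<bar> \<le> L * e" if "j < s" "k < m" for j k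
      using elim(3) that mult_left_mono[OF d_le[OF that(1)] L(1)] by (meson order_trans)
    have "e \<ge> 0"
      unfolding e_def by (intro sum_nonneg) auto
    have Y_le: "\<bar>Y h i k - u0 k\<bar> \<le> h * (a * (L * e))" if "i < s" "k < m" for i k
    proof -
      have "\<bar>\<Sum>j<s. A i j * F h j k\<bar> \<le> (\<Sum>j<s. \<bar>A i j\<bar> * (L * e))"
        using F_le that(2) by (intro sum_abs[THEN order_trans] sum_mono) (auto simp: abs_mult intro: mult_left_mono)
      also have "\<dots> \<le> a * (L * e)"
        unfolding sum_distrib_right[symmetric] a_def using that(1) L(1) \<open>e \<ge> 0\<close>
        by (intro mult_right_mono member_le_sum[of i "{..<s}" "\<lambda>i. \<Sum>j<s. \<bar>A i j\<bar>"] sum_nonneg) auto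
      finally have "h * \<bar>\<Sum>j<s. A i j * F h j k\<bar> \<le> h * (a * (L * e))"
        using elim(2) by (intro mult_left_mono) auto
      moreover have "Y h i k = u0 k + h * (\<Sum>j<s. A i j * F h j k)"
        using elim(4) that(1) by metis
      ultimately show ?thesis
        using elim(2) by (simp add: abs_mult)
    qed
    have "e \<le> (\<Sum>j<s. \<Sum>k<m. h * (a * (L * e)))"
      unfolding e_def by (intro sum_mono) (use Y_le in \<open>auto simp: e_def\<close>)
    then have "e \<le> h * C * e"
      by (simp add: C_def mult_ac)
    then have "e = 0"
      using elim(1) \<open>e \<ge> 0\<close> by (cases "e = 0") auto
    then show ?case
      using F_le by simp
  qed
qed

lemma gamma_bigo:
  assumes "nondegenerate_start f t0 u0"
  shows "(\<lambda>h. gam h - 1) \<in> O[at_right 0](\<lambda>h. h ^ (p - 1))"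
proof (cases "f t0 u0 = (\<lambda>_. 0)")
  case False
  then show ?thesis by (rule gamma_bigo_nonzero_slope)
next
  case True
  then have "\<forall>\<^sub>F h in at_right 0. \<forall>j<s. \<forall>k<m. F h j k = 0"
    using assms unfolding nondegenerate_start_def by (intro slopes_vanish_if_stationary) auto
  with gamma_defect have "\<forall>\<^sub>F h in at_right 0. gam h - 1 = 0"
  proof eventually_elim
    case (elim h)
    have "B (X h) (X h) = 0"
      using elim(2) by (simp add: gram_form_def rk_increment_def)
    with elim(1) show ?case by simp
  qed
  from landau_o.big.in_cong[OF this] show ?thesis
    by simp
qed

text \<open>
  With \<open>e\<close> the error of the ordinary update, the two errors are \<open>e + (\<gamma> - 1) h X\<close> and
  \<open>e + (\<gamma> - 1) h (X - f(t0, u0)) - w\<close>, where \<open>w\<close> is the deviation of \<open>u(t0 + \<gamma> h) - u(t0 + h)\<close> from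
  its linearization \<open>(\<gamma> - 1) h f(t0, u0)\<close>.
\<close>

lemma relaxation_orders:
  assumes "nondegenerate_start f t0 u0"
  shows "approx_of_order (ip_norm ip) (p - 1) (\<lambda>h. relaxation_update s A b ip u0 h (F h)) (\<lambda>h. u (t0 + h))"
    and "approx_of_order (ip_norm ip) p (\<lambda>h. relaxation_update s A b ip u0 h (F h)) (\<lambda>h. u (t0 + gam h * h))"
proof -
  let ?v = "\<lambda>h. relaxation_update s A b ip u0 h (F h)"
  note gam = gamma_bigo[OF assms]
  have gam1: "(\<lambda>h. gam h - 1) \<in> O[at_right 0](\<lambda>_. 1)"
    using landau_o.big_trans[OF gam bigo_power_mono_at_right_0[of 0]] by simp
  have "(\<lambda>h. (gam h - 1) + 1) \<in> O[at_right 0](\<lambda>_. 1)"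
    by (intro sum_in_bigo gam1) simp
  then have gam_1: "(\<lambda>h. gam h) \<in> O[at_right 0](\<lambda>_. 1)"
    by simp
  have "(\<lambda>h. gam h * h) \<in> O[at_right 0](\<lambda>h. 1 * h)"
    by (intro landau_o.big.mult gam_1) simp
  then have gh: "((\<lambda>h. gam h * h) \<longlongrightarrow> 0) (at_right 0)"
    by (intro bigo_id_tendsto_0) simp
  have id0: "((\<lambda>h::real. h) \<longlongrightarrow> 0) (at_right 0)"
    by (rule tendsto_ident_at)
  have Rn_shift: "\<forall>\<^sub>F h in at_right 0. u (t0 + g h) \<in> Rn m" if "(g \<longlongrightarrow> 0) (at_right 0)" for g :: "real \<Rightarrow> real"
    using eventually_compose_filterlim[OF u_Rn, of "\<lambda>h. t0 + g h"] tendsto_add[OF tendsto_const[of t0] that]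
    by simp
  have v_Rn: "\<forall>\<^sub>F h in at_right 0. ?v h \<in> Rn m"
    using X_Rn by eventually_elim (use u0_Rn in \<open>simp add: relaxation_update_def Rn_iff\<close>)
  have diff_Rn: "\<forall>\<^sub>F h in at_right 0. (\<lambda>k. ?v h k - u (t0 + g h) k) \<in> Rn m"
    if "(g \<longlongrightarrow> 0) (at_right 0)" for g :: "real \<Rightarrow> real"
    using v_Rn Rn_shift[OF that] by eventually_elim (simp add: Rn_iff)
  have pw: "h ^ (p - 1) * h = h ^ p" for h :: real
    using p by (simp flip: power_Suc2)

  show "approx_of_order (ip_norm ip) (p - 1) ?v (\<lambda>h. u (t0 + h))"
    unfolding approx_of_order_def
  proof (rule ip_norm_bigo[OF inner diff_Rn[OF id0]])
    fix k assume k: "k < m"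
    have X1: "(\<lambda>h. X h k) \<in> O[at_right 0](\<lambda>_. 1)"
      using increment_tendsto[OF k] by (intro bigoI_tendsto) auto
    have "(\<lambda>h. (gam h - 1) * h * X h k) \<in> O[at_right 0](\<lambda>h. h ^ (p - 1) * h * 1)"
      by (intro landau_o.big.mult gam X1) simp
    then have "(\<lambda>h. (gam h - 1) * h * X h k) \<in> O[at_right 0](\<lambda>h. h ^ p)"
      by (simp only: pw mult_1_right)
    moreover have "(\<lambda>h. u0 k + h * X h k - u (t0 + h) k) \<in> O[at_right 0](\<lambda>h. h ^ p)"
      by (intro landau_o.big_trans[OF increment_error[OF k]] bigo_power_mono_at_right_0) simp
    ultimately have "(\<lambda>h. (gam h - 1) * h * X h k + (u0 k + h * X h k - u (t0 + h) k)) \<in> O[at_right 0](\<lambda>h. h ^ p)"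
      by (rule sum_in_bigo)
    then show "(\<lambda>h. ?v h k - u (t0 + h) k) \<in> O[at_right 0](\<lambda>h. h ^ (p - 1 + 1))"
      using p by (simp add: relaxation_update_def algebra_simps)
  qed

  show "approx_of_order (ip_norm ip) p ?v (\<lambda>h. u (t0 + gam h * h))"
    unfolding approx_of_order_def
  proof (rule ip_norm_bigo[OF inner diff_Rn[OF gh]])
    fix k assume k: "k < m"
    obtain c r where c: "c \<ge> 0" "r > 0" and cr: "\<And>h h' k. k < m \<Longrightarrow> \<bar>h\<bar> < r \<Longrightarrow> \<bar>h'\<bar> < r \<Longrightarrow>
       \<bar>u (t0 + h) k - u (t0 + h') k - (h - h') * f t0 u0 k\<bar> \<le> c * (\<bar>h\<bar> + \<bar>h'\<bar>) * \<bar>h - h'\<bar>"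
      using solution_increment by blast
    let ?w = "\<lambda>h. u (t0 + gam h * h) k - u (t0 + h) k - (gam h - 1) * h * f t0 u0 k"
    have bounds: "\<forall>\<^sub>F h in at_right 0. dist (gam h * h) 0 < r" "\<forall>\<^sub>F h::real in at_right 0. dist h 0 < r"
      using tendstoD[OF gh c(2)] tendstoD[OF id0 c(2)] by auto
    then have "\<forall>\<^sub>F h in at_right 0. norm (?w h) \<le> c * norm ((\<bar>gam h\<bar> + 1) * h * ((gam h - 1) * h))"
    proof eventually_elim
      case (elim h)
      have "(gam h - 1) * h = gam h * h - h"
        by (simp add: left_diff_distrib)
      then have "\<bar>?w h\<bar> \<le> c * (\<bar>gam h * h\<bar> + \<bar>h\<bar>) * \<bar>(gam h - 1) * h\<bar>"
        using cr[OF k, of "gam h * h" h] elim by (simp only: dist_real_def diff_0_right)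
      also have "\<bar>gam h * h\<bar> + \<bar>h\<bar> = \<bar>(\<bar>gam h\<bar> + 1) * h\<bar>"
        unfolding abs_mult by (simp add: distrib_right)
      finally show ?case
        by (simp add: abs_mult mult.assoc)
    qed
    then have "?w \<in> O[at_right 0](\<lambda>h. (\<bar>gam h\<bar> + 1) * h * ((gam h - 1) * h))"
      by (rule bigoI)
    also have "(\<lambda>h. (\<bar>gam h\<bar> + 1) * h * ((gam h - 1) * h)) \<in> O[at_right 0](\<lambda>h. 1 * h * (h ^ (p - 1) * h))"
      by (intro landau_o.big.mult gam sum_in_bigo) (use gam_1 in simp_all)
    finally have w: "?w \<in> O[at_right 0](\<lambda>h. h ^ (p + 1))"
      unfolding pw by simp
    have "(\<lambda>h. (gam h - 1) * h * (X h k - f t0 u0 k)) \<in> O[at_right 0](\<lambda>h. h ^ (p - 1) * h * h)"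
      by (intro landau_o.big.mult gam increment_consistent k) simp
    then have "(\<lambda>h. (gam h - 1) * h * (X h k - f t0 u0 k)) \<in> O[at_right 0](\<lambda>h. h ^ (p + 1))"
      unfolding pw by (simp add: mult.commute)
    from sum_in_bigo(1)[OF increment_error[OF k] sum_in_bigo(2)[OF this w]]
    show "(\<lambda>h. ?v h k - u (t0 + gam h * h) k) \<in> O[at_right 0](\<lambda>h. h ^ (p + 1))"
      by (simp add: relaxation_update_def algebra_simps)
  qed
qed

end

section \<open>Order of the relaxed method\<close>

theorem corollary5:
  fixes m s p :: nat
    and A :: "nat \<Rightarrow> nat \<Rightarrow> real" and b :: "nat \<Rightarrow> real"
    and ip :: "(nat \<Rightarrow> real) \<Rightarrow> (nat \<Rightarrow> real) \<Rightarrow> real"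
  assumes "p \<ge> 1"
    and "rk_order s A b p"
    and "inner_product_on m ip"
  shows "\<exists>K. \<forall>f t0 u Y.
     smooth_rhs K m f \<longrightarrow> solves_ode m f t0 u \<longrightarrow> rk_stages m s A f t0 (u t0) Y \<longrightarrow>
     nondegenerate_start f t0 (u t0) \<longrightarrow>
     (let F = rk_slope s A f t0 Y;
          \<gamma> = (\<lambda>h. relaxation_gamma s A b ip (F h));
          v = (\<lambda>h. relaxation_update s A b ip (u t0) h (F h))
      in approx_of_order (ip_norm ip) (p - 1) v (\<lambda>h. u (t0 + h)) \<and>
         approx_of_order (ip_norm ip) p v (\<lambda>h. u (t0 + \<gamma> h * h)))"
proof -
  obtain K where K: "\<And>m f t0 u Y. smooth_rhs K m f \<Longrightarrow> solves_ode m f t0 u \<Longrightarrow>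
        rk_stages m s A f t0 (u t0) Y \<Longrightarrow>
        approx_of_order (\<lambda>x. L2_set x {..<m}) p
          (\<lambda>h. rk_update s b (u t0) h (rk_slope s A f t0 Y h)) (\<lambda>h. u (t0 + h))"
    using assms(2) unfolding rk_order_def by blast
  show ?thesis
  proof (intro exI[of _ "Suc K"] allI impI)
    fix f t0 u Y
    assume "smooth_rhs (Suc K) m f" "solves_ode m f t0 u" "rk_stages m s A f t0 (u t0) Y"
    then interpret relaxation_step m s p K A b ip f t0 u Y
      using K assms by unfold_locales
    assume "nondegenerate_start f t0 (u t0)"
    from relaxation_orders[OF this]
    show "let F = rk_slope s A f t0 Y;
          \<gamma> = (\<lambda>h. relaxation_gamma s A b ip (F h));
          v = (\<lambda>h. relaxation_update s A b ip (u t0) h (F h))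
      in approx_of_order (ip_norm ip) (p - 1) v (\<lambda>h. u (t0 + h)) \<and>
         approx_of_order (ip_norm ip) p v (\<lambda>h. u (t0 + \<gamma> h * h))"
      by (simp add: Let_def)
  qed
qed

end
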